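(* Let $\omega^2+\omega+1=0$. For $\lambda\in\{-2,-2\omega,-2\omega^2,0,1,\omega,\omega^2\}$, let $\mathcal{A}(\lambda)$ and $\mathcal{B}(\lambda)$ be the degenerations of the Hesse arrangement of conics defined in the context. Then $\mathcal{A}(\lambda)$ is a free conic-line arrangement with exponents $(7,13)$ for every $\lambda\in\{-2,-2\omega,-2\omega^2,0,1,\omega,\omega^2\}$. Moreover, $\mathcal{B}(\lambda)$ is a free conic arrangement with exponents $(7,10)$ for every $\lambda\in\{1,\omega,\omega^2\}$.
   Context: Define quadratic forms in $x,y,z$ depending on $\lambda\in\mathbb{C}$: $f_1(\lambda)=x^{2}+(\lambda+1)(\omega xy+\omega^{2}xz+yz)+\omega^{2}y^{2}+\omega z^{2}$, $f_2(\lambda)=x^{2}+(\lambda+1)(\omega^{2}xy+\omega xz+yz)+\omega y^{2}+\omega^{2}z^{2}$, $f_3(\lambda)=xy-\lambda z^{2}$, $f_4(\lambda)=x^{2}+(\omega\lambda+1)(xy+\omega xz+\omega yz)+y^{2}+\omega^{2}z^{2}$, $f_5(\lambda)=x^{2}+(\omega^{2}\lambda+1)(xy+\omega^{2}xz+\omega^{2}yz)+y^{2}+\omega z^{2}$, $f_6(\lambda)=x^{2}+(\omega\lambda+\omega^{2})(xy+yz+\omega xz)+\omega y^{2}+z^{2}$, $f_7(\lambda)=-\lambda y^{2}+xz$, $f_8(\lambda)=x^{2}+(\omega^{2}\lambda+\omega)(xy+yz+\omega^{2}xz)+\omega^{2}y^{2}+z^{2}$, $f_9(\lambda)=x^{2}+(\lambda+\omega^{2})(xy+xz+\omega^{2}yz)+\omega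 y^{2}+\omega z^{2}$, $f_{10}(\lambda)=x^{2}+(\lambda+\omega)(xy+xz+\omega yz)+\omega^{2}(y^{2}+z^{2})$, $f_{11}(\lambda)=\lambda x^{2}-yz$, $f_{12}(\lambda)=x^{2}+(\lambda+1)(xy+xz+yz)+y^{2}+z^{2}$, and put $f(\lambda)=f_1(\lambda)f_2(\lambda)\cdots f_{12}(\lambda)$. For each $\lambda\in\{-2,-2\omega,-2\omega^2,0,1,\omega,\omega^2\}$ the polynomial $f(\lambda)$ has 3 linear factors, each occurring with exponent 2, so $f(\lambda)=0$ is a multiarrangement $\mathcal{C}(\lambda)$ formed by 9 smooth conics and 3 double lines in $\mathbb{P}^2_{\mathbb{C}}$. $\mathcal{A}(\lambda)$ denotes the reduced conic-line arrangement obtained from $\mathcal{C}(\lambda)$ by replacing the 3 double lines by the corresponding reduced lines, and $\mathcal{B}(\lambda)$ denotes the subarrangement of $\mathcal{A}(\lambda)$ consisting of just the 9 smooth conics. Freeness: let $S=\mathbb{C}[x,y,z]$, let $C:f=0$ be a reduced curve of degree $d$ in $\mathbb{P}^2_{\mathbb{C}}$, and let $M(f)=S/J_f$ with $J_f$ the ideal generated by the partial derivatives of $f$. $C$ is $m$-syzygy if $M(f)$ has minimal graded free resolution $$0\to\bigoplus_{i=1}^{m-2}S(-e_i)\to\bigoplus_{i=1}^{m}S(1-d-d_i)\to S^3(1-d)\to S\to M(f)\to 0$$ with $e_1\le\cdots\le e_{m-2}$ and $1\le d_1\le\cdots\le d_m$. $C$ is free if $m=2$ and $d_1+d_2=d-1$;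 the pair $(d_1,d_2)$ is then called the exponents of $C$. *)

theory Defs
  imports
    "HOL-Computational_Algebra.Computational_Algebra"
    "HOL-Computational_Algebra.Field_as_Ring"
    "Jordan_Normal_Form.Matrix_Kernel"
begin

(* S = C[x,y,z] is represented as C[z][y][x]: x is the variable of the outermost
   polynomial layer and z that of the innermost one. *)
type_synonym poly3 = "complex poly poly poly"

definition cnst :: "complex \<Rightarrow> poly3" where
  "cnst c = [:[:[:c:]:]:]"

definition varX :: poly3 where "varX = [:0, 1:]"
definition varY :: poly3 where "varY = [:[:0, 1:]:]"
definition varZ :: poly3 where "varZ = [:[:[:0, 1:]:]:]"

definition coeff3 :: "poly3 \<Rightarrow> nat \<Rightarrow> nat \<Rightarrow> nat \<Rightarrow> complex" where
  "coeff3 p i j k = coeff (coeff (coeff p i) j) k"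

definition eval3 :: "poly3 \<Rightarrow> complex \<Rightarrow> complex \<Rightarrow> complex \<Rightarrow> complex" where
  "eval3 p a b c = poly (poly (poly p [:[:a:]:]) [:b:]) c"

definition dX :: "poly3 \<Rightarrow> poly3" where "dX p = pderiv p"
definition dY :: "poly3 \<Rightarrow> poly3" where "dY p = map_poly pderiv p"
definition dZ :: "poly3 \<Rightarrow> poly3" where "dZ p = map_poly (map_poly pderiv) p"

(* The degree is an integer because graded components of twisted modules S(k) are needed;
   0 is homogeneous of every degree and is the only form of negative degree. *)
definition homogeneous :: "int \<Rightarrow> poly3 \<Rightarrow> bool" where
  "homogeneous d p \<longleftrightarrow> (\<forall>i j k. coeff3 p i j k \<noteq> 0 \<longrightarrow> int (i + j + k) = d)"


(* A list ts of integers stands for the graded free module F(ts) = S(ts!0) + S(ts!1) + ...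
   (direct sum), whose elements are the vectors of dimension length ts.  Since S(k) is
   generated in degree -k, a degree-preserving S-linear map F(ss) -> F(ts) is a matrix
   whose (i,j) entry is a form of degree ts!i - ss!j. *)
definition graded_map :: "int list \<Rightarrow> int list \<Rightarrow> poly3 mat \<Rightarrow> bool" where
  "graded_map ss ts M \<longleftrightarrow>
     M \<in> carrier_mat (length ts) (length ss) \<and>
     (\<forall>i<length ts. \<forall>j<length ss. homogeneous (ts ! i - ss ! j) (M $$ (i, j)))"

definition mat_image :: "poly3 mat \<Rightarrow> poly3 vec set" where
  "mat_image M = {M *\<^sub>v v | v. v \<in> carrier_vec (dim_col M)}"

(* The image of M lies in (x,y,z) times the target. *)
definition minimal_map :: "poly3 mat \<Rightarrow> bool" where
  "minimal_map M \<longleftrightarrow> (\<forall>i<dim_row M. \<forall>j<dim_col M. coeff3 (M $$ (i, j)) 0 0 0 = 0)"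

(* 0 -> F(ts3) -> F(ts2) -> F(ts1) -> S -> S/I -> 0 is exact and minimal, for some choice of
   graded maps; exactness at S says that the image of F(ts1) -> S is the ideal I. *)
definition minimal_graded_free_resolution ::
    "poly3 set \<Rightarrow> int list \<Rightarrow> int list \<Rightarrow> int list \<Rightarrow> bool" where
  "minimal_graded_free_resolution I ts1 ts2 ts3 \<longleftrightarrow>
     (\<exists>M1 M2 M3.
        graded_map ts1 [0] M1 \<and> graded_map ts2 ts1 M2 \<and> graded_map ts3 ts2 M3 \<and>
        minimal_map M1 \<and> minimal_map M2 \<and> minimal_map M3 \<and>
        mat_image M1 = {v \<in> carrier_vec 1. v $ 0 \<in> I} \<and>
        mat_kernel M1 = mat_image M2 \<and>
        mat_kernel M2 = mat_image M3 \<and>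
        mat_kernel M3 = {0\<^sub>v (length ts3)})"


definition jacobian_ideal :: "poly3 \<Rightarrow> poly3 set" where
  "jacobian_ideal f = {a * dX f + b * dY f + c * dZ f | a b c. True}"

definition reduced_curve :: "nat \<Rightarrow> poly3 \<Rightarrow> bool" where
  "reduced_curve d f \<longleftrightarrow> f \<noteq> 0 \<and> homogeneous (int d) f \<and> squarefree f"

(* The Milnor algebra S/J_f has minimal resolution
   0 -> sum S(-e_i) -> sum S(1-d-d_i) -> S(1-d)^3 -> S -> S/J_f -> 0
   with m numbers d_i and m-2 numbers e_i. *)
definition syzygy_curve :: "nat \<Rightarrow> nat \<Rightarrow> nat list \<Rightarrow> int list \<Rightarrow> poly3 \<Rightarrow> bool" where
  "syzygy_curve m d ds es f \<longleftrightarrow>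
     reduced_curve d f \<and>
     length ds = m \<and> length es + 2 = m \<and>
     sorted ds \<and> (\<forall>k\<in>set ds. 1 \<le> k) \<and> sorted es \<and>
     minimal_graded_free_resolution (jacobian_ideal f)
       (replicate 3 (1 - int d))
       (map (\<lambda>k. 1 - int d - int k) ds)
       (map uminus es)"

definition free_with_exponents :: "poly3 \<Rightarrow> nat \<Rightarrow> nat \<Rightarrow> bool" where
  "free_with_exponents f d1 d2 \<longleftrightarrow>
     (\<exists>d es. syzygy_curve 2 d [d1, d2] es f \<and> d1 + d2 = d - 1)"


definition is_line :: "poly3 \<Rightarrow> bool" where
  "is_line q \<longleftrightarrow> q \<noteq> 0 \<and> homogeneous 1 q"

definition is_smooth_conic :: "poly3 \<Rightarrow> bool" where
  "is_smooth_conic q \<longleftrightarrow> q \<noteq> 0 \<and> homogeneous 2 q \<and>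
     \<not> (\<exists>a b c. (a, b, c) \<noteq> (0, 0, 0) \<and> eval3 q a b c = 0 \<and>
        eval3 (dX q) a b c = 0 \<and> eval3 (dY q) a b c = 0 \<and> eval3 (dZ q) a b c = 0)"

(* A reduced arrangement is the set of the equations of its members; its defining polynomial
   is the product of this set. *)
definition conic_line_arrangement :: "poly3 set \<Rightarrow> bool" where
  "conic_line_arrangement A \<longleftrightarrow> finite A \<and> (\<forall>q\<in>A. is_line q \<or> is_smooth_conic q)"

definition conic_arrangement :: "poly3 set \<Rightarrow> bool" where
  "conic_arrangement A \<longleftrightarrow> finite A \<and> (\<forall>q\<in>A. is_smooth_conic q)"


(* The forms f_1, ..., f_12, in this order; l is the parameter lambda. *)
definition hesse_conics :: "complex \<Rightarrow> complex \<Rightarrow> poly3 list" where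
  "hesse_conics \<omega> l =
    (let x = varX; y = varY; z = varZ; c = cnst in
     [x^2 + c (l + 1) * (c \<omega> * x * y + c (\<omega>^2) * x * z + y * z) + c (\<omega>^2) * y^2 + c \<omega> * z^2,
      x^2 + c (l + 1) * (c (\<omega>^2) * x * y + c \<omega> * x * z + y * z) + c \<omega> * y^2 + c (\<omega>^2) * z^2,
      x * y - c l * z^2,
      x^2 + c (\<omega> * l + 1) * (x * y + c \<omega> * x * z + c \<omega> * y * z) + y^2 + c (\<omega>^2) * z^2,
      x^2 + c (\<omega>^2 * l + 1) * (x * y + c (\<omega>^2) * x * z + c (\<omega>^2) * y * z) + y^2 + c \<omega> * z^2,
      x^2 + c (\<omega> * l + \<omega>^2) * (x * y + y * z + c \<omega> * x * z) + c \<omega> * y^2 + z^2,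
      - (c l * y^2) + x * z,
      x^2 + c (\<omega>^2 * l + \<omega>) * (x * y + y * z + c (\<omega>^2) * x * z) + c (\<omega>^2) * y^2 + z^2,
      x^2 + c (l + \<omega>^2) * (x * y + x * z + c (\<omega>^2) * y * z) + c \<omega> * y^2 + c \<omega> * z^2,
      x^2 + c (l + \<omega>) * (x * y + x * z + c \<omega> * y * z) + c (\<omega>^2) * (y^2 + z^2),
      c l * x^2 - y * z,
      x^2 + c (l + 1) * (x * y + x * z + y * z) + y^2 + z^2])"

definition hesse_poly :: "complex \<Rightarrow> complex \<Rightarrow> poly3" where
  "hesse_poly \<omega> l = prod_list (hesse_conics \<omega> l)"

(* The multiarrangement f = 0: irreducible components (normalized equations) with multiplicity. *)
definition arrangement_C :: "complex \<Rightarrow> complex \<Rightarrow> poly3 multiset" where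
  "arrangement_C \<omega> l = prime_factorization (hesse_poly \<omega> l)"

(* Passing to the underlying set replaces the double lines by reduced lines. *)
definition arrangement_A :: "complex \<Rightarrow> complex \<Rightarrow> poly3 set" where
  "arrangement_A \<omega> l = set_mset (arrangement_C \<omega> l)"

definition arrangement_B :: "complex \<Rightarrow> complex \<Rightarrow> poly3 set" where
  "arrangement_B \<omega> l = {q \<in> arrangement_A \<omega> l. is_smooth_conic q}"

end

(* The Hesse arrangements are invariant under the group generated by the permutations of x, y, z and by
   diag(1, omega, omega^2), whose invariants are A = x^3+y^3+z^3, B = xyz and C = x^3y^3+y^3z^3+z^3x^3.
   The twelve conics form four orbits of three, and the product of each orbit is a sextic that is
   linear in C.  For the special values of lambda one of the orbits degenerates to three double lines,
   that is, to the square of a cubic E, and all four sextics lie in the pencil spanned by E^2 and a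
   second sextic H; up to a unit, the three remaining orbits multiply to e E^6 - H^3 with e a constant.
   Hence the equation f of the arrangement is a polynomial in E and H, and grad E x grad H is a syzygy
   of degree 7.  A second syzygy is a derivation that maps (E, H) to a multiple of (f_H, - f_E); it is
   found among the combinations of the invariant derivations (x,y,z), (x^4,y^4,z^4) and
   (y^2z^2,z^2x^2,x^2y^2).  The cross product of the two syzygies is a multiple of grad f, so f is
   free by Saito's criterion. *)

theory Submission
  imports Defs
begin

section \<open>Partial derivatives and homogeneous polynomials\<close>

text \<open>Write t(g) for the derivative of g along t. Since (grad E x grad H) x t = t(E) grad H -
  t(H) grad E, it is enough that t(E) and t(H) are the same constant multiple of f_H and - f_E. The
  shape e E^6 - H^3 reflects the position of four members of the pencil: the Moebius map of order 3
  that permutes the three nondegenerate orbits cyclically fixes the member E^2, and H is its other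
  fixed member. For nonzero \<lambda> this gives H = E^2 - 9 G, with G a multiple of the product of
  the coordinate conics. The six nonzero values of \<lambda> are treated together as \<mu> k^2 with
  k^3 = 1 and \<mu> either 1 or -2: the orbit with \<kappa> = k degenerates, and up to a constant
  factor k enters the products only through k B. The members of an arrangement are normalized primes
  of a factorization, so each conic needs a proof of irreducibility besides one of smoothness, and
  constants such as \<open>- k / (27 * l)\<close> keep track of the normalization.\<close>

lemma cnst_simps [simp]:
  "cnst 0 = 0" "cnst 1 = 1" "cnst (a + b) = cnst a + cnst b" "cnst (a * b) = cnst a * cnst b"
  "cnst (a - b) = cnst a - cnst b" "cnst (- a) = - cnst a"
  by (simp_all add: cnst_def one_pCons)

lemma cnst_power [simp]: "cnst (a ^ n) = cnst a ^ n"
  by (induction n) simp_all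

lemma cnst_numeral [simp]: "cnst (numeral n) = numeral n"
  by (simp add: cnst_def numeral_poly)

lemma cnst_eq_0_iff [simp]: "cnst a = 0 \<longleftrightarrow> a = 0"
  by (simp add: cnst_def)

lemma map_poly_additive:
  fixes f :: "'a::comm_ring_1 \<Rightarrow> 'b::comm_ring_1"
  assumes "f 0 = 0" "\<And>a b. f (a + b) = f a + f b"
  shows "map_poly f (p + q) = map_poly f p + map_poly f q"
  using assms by (intro poly_eqI) (simp add: coeff_map_poly)

text \<open>The variables y and z live in the coefficient layers: one use of this product rule gives
  \<open>dY\<close>, two nested uses give \<open>dZ\<close>.\<close>

lemma map_poly_derivation:
  fixes d :: "'a::comm_ring_1 \<Rightarrow> 'a"
  assumes add: "\<And>a b. d (a + b) = d a + d b" and mult: "\<And>a b. d (a * b) = a * d b + d a * b"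
  shows "map_poly d (p * q) = p * map_poly d q + map_poly d p * q"
proof -
  have d0: "d 0 = 0" using add[of 0 0] by simp
  have s: "d (sum f A) = (\<Sum>i\<in>A. d (f i))" for f :: "nat \<Rightarrow> 'a" and A
    by (induction A rule: infinite_finite_induct) (simp_all add: d0 add)
  show ?thesis
    by (intro poly_eqI) (simp add: coeff_map_poly d0 coeff_mult s mult sum.distrib)
qed

lemma dX_add [simp]: "dX (p + q) = dX p + dX q"
  by (simp add: dX_def pderiv_add)
lemma dY_add [simp]: "dY (p + q) = dY p + dY q"
  by (simp add: dY_def map_poly_additive pderiv_add)
lemma dZ_add [simp]: "dZ (p + q) = dZ p + dZ q"
  by (simp add: dZ_def map_poly_additive pderiv_add)

lemma dX_mult: "dX (p * q) = p * dX q + dX p * q"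
  by (simp add: dX_def pderiv_mult mult.commute)
lemma dY_mult: "dY (p * q) = p * dY q + dY p * q"
  unfolding dY_def by (rule map_poly_derivation) (simp_all add: pderiv_add pderiv_mult mult.commute)
lemma dZ_mult: "dZ (p * q) = p * dZ q + dZ p * q"
  unfolding dZ_def
  by (intro map_poly_derivation map_poly_additive) (simp_all add: pderiv_add pderiv_mult mult.commute)

lemma d_cnst [simp]: "dX (cnst c) = 0" "dY (cnst c) = 0" "dZ (cnst c) = 0"
  by (simp_all add: dX_def dY_def dZ_def cnst_def map_poly_pCons pderiv_pCons)

lemma d_var [simp]:
  "dX varX = 1" "dX varY = 0" "dX varZ = 0"
  "dY varX = 0" "dY varY = 1" "dY varZ = 0"
  "dZ varX = 0" "dZ varY = 0" "dZ varZ = 1"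
  by (simp_all add: dX_def dY_def dZ_def varX_def varY_def varZ_def map_poly_pCons pderiv_pCons one_pCons)

lemma d_numeral [simp]: "dX (numeral n) = 0" "dY (numeral n) = 0" "dZ (numeral n) = 0"
  using d_cnst[of "numeral n"] by simp_all

lemma d_0_1 [simp]: "dX 0 = 0" "dY 0 = 0" "dZ 0 = 0" "dX 1 = 0" "dY 1 = 0" "dZ 1 = 0"
  using d_cnst[of 0] d_cnst[of 1] by simp_all

lemma d_minus [simp]: "dX (- p) = - dX p" "dY (- p) = - dY p" "dZ (- p) = - dZ p"
  using dX_add[of p "- p"] dY_add[of p "- p"] dZ_add[of p "- p"]
  by (simp_all add: eq_neg_iff_add_eq_0 add.commute)

lemma d_diff [simp]:
  "dX (p - q) = dX p - dX q" "dY (p - q) = dY p - dY q" "dZ (p - q) = dZ p - dZ q"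
  using dX_add[of p "- q"] dY_add[of p "- q"] dZ_add[of p "- q"] by simp_all

lemma coeff3_simps [simp]:
  "coeff3 0 i j k = 0" "coeff3 (p + q) i j k = coeff3 p i j k + coeff3 q i j k"
  "coeff3 (p - q) i j k = coeff3 p i j k - coeff3 q i j k"
  "coeff3 (- p) i j k = - coeff3 p i j k"
  by (simp_all add: coeff3_def)

lemma coeff3_mult:
  "coeff3 (p * q) i j k =
     (\<Sum>a\<le>i. \<Sum>b\<le>j. \<Sum>c\<le>k. coeff3 p a b c * coeff3 q (i - a) (j - b) (k - c))"
  by (simp add: coeff3_def coeff_mult coeff_sum)

lemma coeff3_cnst_mult: "coeff3 (cnst c * p) i j k = c * coeff3 p i j k"
  by (simp add: coeff3_def cnst_def)

lemma poly3_eqI: "(\<And>i j k. coeff3 p i j k = coeff3 q i j k) \<Longrightarrow> p = q"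
  by (auto simp: coeff3_def intro!: poly_eqI)

lemma homogeneous_0 [simp]: "homogeneous d 0"
  by (simp add: homogeneous_def)

lemma homogeneous_add: "homogeneous d p \<Longrightarrow> homogeneous d q \<Longrightarrow> homogeneous d (p + q)"
  unfolding homogeneous_def by (metis add_0 coeff3_simps(2))

lemma homogeneous_minus: "homogeneous d p \<Longrightarrow> homogeneous d (- p)"
  by (simp add: homogeneous_def)

lemma homogeneous_diff: "homogeneous d p \<Longrightarrow> homogeneous d q \<Longrightarrow> homogeneous d (p - q)"
  using homogeneous_add[OF _ homogeneous_minus] by fastforce

lemma homogeneous_mult:
  assumes "homogeneous d p" "homogeneous e q"
  shows "homogeneous (d + e) (p * q)"
  unfolding homogeneous_def
proof (intro allI impI)
  fix i j k assume "coeff3 (p * q) i j k \<noteq> 0"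
  then obtain a b c where le: "a \<le> i" "b \<le> j" "c \<le> k"
    and nz: "coeff3 p a b c * coeff3 q (i - a) (j - b) (k - c) \<noteq> 0"
    unfolding coeff3_mult by (metis (no_types, lifting) atMost_iff sum.neutral)
  have "int (a + b + c) = d" "int ((i - a) + (j - b) + (k - c)) = e"
    using nz assms unfolding homogeneous_def by auto
  with le show "int (i + j + k) = d + e" by linarith
qed

lemma homogeneous_cnst [simp]: "homogeneous 0 (cnst c)"
  by (auto simp: homogeneous_def coeff3_def cnst_def coeff_pCons split: nat.splits)

lemma homogeneous_numeral [simp]: "homogeneous 0 (numeral n)"
  using homogeneous_cnst[of "numeral n"] by simp

lemma homogeneous_1 [simp]: "homogeneous 0 1"
  using homogeneous_cnst[of 1] by simp

lemma homogeneous_var [simp]: "homogeneous 1 varX" "homogeneous 1 varY" "homogeneous 1 varZ"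
  by (auto simp: homogeneous_def coeff3_def varX_def varY_def varZ_def coeff_pCons split: nat.splits)

lemma homogeneous_power: "homogeneous d p \<Longrightarrow> homogeneous (int n * d) (p ^ n)"
  by (induction n) (auto dest: homogeneous_mult simp: algebra_simps)

lemma coeff_of_nat_mult: "coeff (of_nat n * p) m = of_nat n * coeff p m"
  by (simp add: of_nat_poly)

lemma coeff3_dX: "coeff3 (dX p) i j k = of_nat (Suc i) * coeff3 p (Suc i) j k"
  by (simp add: coeff3_def dX_def coeff_pderiv coeff_of_nat_mult del: of_nat_Suc)

lemma coeff3_dY: "coeff3 (dY p) i j k = of_nat (Suc j) * coeff3 p i (Suc j) k"
  by (simp add: coeff3_def dY_def coeff_map_poly coeff_pderiv coeff_of_nat_mult del: of_nat_Suc)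

lemma coeff3_dZ: "coeff3 (dZ p) i j k = of_nat (Suc k) * coeff3 p i j (Suc k)"
  by (simp add: coeff3_def dZ_def coeff_map_poly coeff_pderiv del: of_nat_Suc)

lemma homogeneous_d:
  assumes "homogeneous d p"
  shows "homogeneous (d - 1) (dX p)" "homogeneous (d - 1) (dY p)" "homogeneous (d - 1) (dZ p)"
  using assms unfolding homogeneous_def coeff3_dX coeff3_dY coeff3_dZ
  by (fastforce simp del: of_nat_Suc)+

lemma coeff3_var_mult:
  "coeff3 (varX * p) i j k = (case i of 0 \<Rightarrow> 0 | Suc i' \<Rightarrow> coeff3 p i' j k)"
  "coeff3 (varY * p) i j k = (case j of 0 \<Rightarrow> 0 | Suc j' \<Rightarrow> coeff3 p i j' k)"
  "coeff3 (varZ * p) i j k = (case k of 0 \<Rightarrow> 0 | Suc k' \<Rightarrow> coeff3 p i j k')"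
  by (auto simp: coeff3_def varX_def varY_def varZ_def coeff_pCons split: nat.splits)

text \<open>The left side multiplies the monomial with exponents i, j, k by i + j + k, which is
  \<open>d\<close> wherever the coefficient is nonzero.\<close>

lemma euler_homogeneous:
  assumes "homogeneous (int d) p"
  shows "varX * dX p + varY * dY p + varZ * dZ p = of_nat d * p"
proof (rule poly3_eqI)
  fix i j k
  have *: "of_nat d * p = cnst (of_nat d) * p"
    by (simp add: cnst_def of_nat_poly)
  have "coeff3 (varX * dX p + varY * dY p + varZ * dZ p) i j k = of_nat (i + j + k) * coeff3 p i j k"
    by (auto simp: coeff3_var_mult coeff3_dX coeff3_dY coeff3_dZ algebra_simps split: nat.splits)
  also have "\<dots> = of_nat d * coeff3 p i j k"
    using assms unfolding homogeneous_def by (metis mult_eq_0_iff of_nat_eq_iff)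
  finally show "coeff3 (varX * dX p + varY * dY p + varZ * dZ p) i j k = coeff3 (of_nat d * p) i j k"
    by (simp add: * coeff3_cnst_mult)
qed

section \<open>Saito's criterion\<close>

no_notation fps_nth (infixl "$" 75)

lemma dvd_pderiv_imp_const:
  fixes p :: "'a::{idom, semiring_char_0} poly"
  assumes "p dvd pderiv p" shows "degree p = 0"
proof (rule ccontr)
  assume "degree p \<noteq> 0"
  then have "pderiv p \<noteq> 0" by (simp add: pderiv_eq_0_iff)
  with assms have "degree p \<le> degree (pderiv p)" by (intro dvd_imp_degree_le) auto
  with \<open>degree p \<noteq> 0\<close> show False by (simp add: degree_pderiv)
qed

text \<open>In characteristic 0 a nonconstant polynomial cannot divide its derivative, so each
  hypothesis removes one variable from \<open>p\<close>: x, then y, then z.\<close>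

lemma dvd_partials_imp_const:
  assumes "p dvd dX p" "p dvd dY p" "p dvd dZ p"
  obtains c where "p = cnst c"
proof -
  from assms(1) have "degree p = 0" by (simp add: dX_def dvd_pderiv_imp_const)
  then obtain q where p: "p = [:q:]" by (rule degree_eq_zeroE)
  have "q dvd pderiv q" using assms(2) by (simp add: p dY_def map_poly_pCons)
  then have "degree q = 0" by (rule dvd_pderiv_imp_const)
  then obtain r where q: "q = [:r:]" by (rule degree_eq_zeroE)
  have "r dvd pderiv r" using assms(3) by (simp add: p q dZ_def map_poly_pCons)
  then have "degree r = 0" by (rule dvd_pderiv_imp_const)
  then obtain c where "r = [:c:]" by (rule degree_eq_zeroE)
  with p q have "p = cnst c" by (simp add: cnst_def)
  then show ?thesis by (rule that)
qed

lemma is_unit_cnst: "c \<noteq> 0 \<Longrightarrow> is_unit (cnst c)"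
  by (simp add: cnst_def is_unit_const_poly_iff dvd_field_iff)

text \<open>By Euler's relation a common prime factor \<open>p\<close> of the partials divides f,
  say f = p h with h prime to \<open>p\<close>; the product rule then makes \<open>p\<close> divide
  its own partials. This coprimality takes the place of a codimension argument in the proof of
  exactness.\<close>

lemma squarefree_imp_coprime_partials:
  assumes hom: "homogeneous (int d) f" and d: "d > 0" and sf: "squarefree f"
    and p: "prime_elem p" "p dvd dX f" "p dvd dY f" "p dvd dZ f"
  shows False
proof -
  have "p dvd of_nat d * f"
    unfolding euler_homogeneous[OF hom, symmetric] using p by simp
  moreover have "of_nat d = cnst (of_nat d)"
    by (simp add: cnst_def of_nat_poly)
  ultimately have "p dvd f"
    using d is_unit_cnst[of "of_nat d"] by (simp add: dvd_mult_unit_iff')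
  then obtain h where f: "f = p * h" by blast
  have nh: "\<not> p dvd h"
  proof
    assume "p dvd h"
    then have "p\<^sup>2 dvd f" by (simp add: f power2_eq_square)
    then have "is_unit p" using sf unfolding squarefree_def by blast
    then show False using p(1) by simp
  qed
  have "p dvd h * dX p" "p dvd h * dY p" "p dvd h * dZ p"
    using p(2-4) unfolding f dX_mult dY_mult dZ_mult
    by (simp_all add: dvd_add_right_iff mult.commute)
  then have "p dvd dX p" "p dvd dY p" "p dvd dZ p"
    using p(1) nh by (auto simp: prime_elem_dvd_mult_iff)
  then obtain c where "p = cnst c" by (rule dvd_partials_imp_const)
  with p(1) is_unit_cnst[of c] show False by (cases "c = 0") auto
qed

text \<open>In a factorial ring \<open>u1\<close> times the gcd of the three g's is the gcd of
  \<open>u1 * g1\<close>, \<open>u1 * g2\<close>, \<open>u1 * g3\<close>, and by parallelism all of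
  these are multiples of \<open>g1\<close>.\<close>

lemma parallel_imp_multiple:
  fixes u1 u2 u3 g1 g2 g3 :: poly3
  assumes par: "u1 * g2 = u2 * g1" "u1 * g3 = u3 * g1"
    and cop: "\<And>p. prime_elem p \<Longrightarrow> p dvd g1 \<Longrightarrow> p dvd g2 \<Longrightarrow> p dvd g3 \<Longrightarrow> False"
    and nz: "g1 \<noteq> 0"
  shows "\<exists>r. u1 = r * g1 \<and> u2 = r * g2 \<and> u3 = r * g3"
proof -
  let ?h = "gcd g1 (gcd g2 g3)"
  have "is_unit ?h"
  proof (rule ccontr)
    assume "\<not> is_unit ?h"
    with nz obtain p where "prime p" "p dvd ?h"
      by (metis gcd_eq_0_iff prime_divisor_exists)
    with cop[of p] show False by auto
  qed
  have "g1 dvd gcd (u1 * g1) (gcd (u1 * g2) (u1 * g3))"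
    using par by simp
  then have "g1 dvd u1 * ?h"
    by (simp add: gcd_mult_left)
  with \<open>is_unit ?h\<close> have "g1 dvd u1" by (simp add: dvd_mult_unit_iff)
  then obtain r where r: "u1 = r * g1" by (metis dvdE mult.commute)
  with par nz have "u2 = r * g2" "u3 = r * g3" by (auto simp: ac_simps)
  with r show ?thesis by blast
qed

lemma parallel_imp_multiple':
  fixes u1 u2 u3 g1 g2 g3 :: poly3
  assumes par: "u1 * g2 = u2 * g1" "u1 * g3 = u3 * g1" "u2 * g3 = u3 * g2"
    and cop: "\<And>p. prime_elem p \<Longrightarrow> p dvd g1 \<Longrightarrow> p dvd g2 \<Longrightarrow> p dvd g3 \<Longrightarrow> False"
  shows "\<exists>r. u1 = r * g1 \<and> u2 = r * g2 \<and> u3 = r * g3"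
proof -
  \<comment> \<open>Any prime would do: if all three entries were zero, it would be a common
    divisor.\<close>
  have "prime_elem varX"
    by (simp add: varX_def prime_elem_linear_poly flip: irreducible_linear_poly)
  with cop have "g1 \<noteq> 0 \<or> g2 \<noteq> 0 \<or> g3 \<noteq> 0" by auto
  then show ?thesis
    using parallel_imp_multiple[of u1 g2 u2 g1 g3 u3] parallel_imp_multiple[of u2 g1 u1 g2 g3 u3]
      parallel_imp_multiple[of u3 g1 u1 g3 g2 u2] par cop
    by metis
qed

text \<open>A nonzero v parallel to both a and b would make a and b parallel, against
  \<open>ab\<close>. Over a domain this is seen by multiplying each entry of v by the 2x2 minors of
  a and b.\<close>

lemma cross_zero_imp_zero:
  fixes a1 a2 a3 b1 b2 b3 v1 v2 v3 :: "'a::idom"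
  assumes va: "v1 * a2 = v2 * a1" "v1 * a3 = v3 * a1" "v2 * a3 = v3 * a2"
    and vb: "v1 * b2 = v2 * b1" "v1 * b3 = v3 * b1" "v2 * b3 = v3 * b2"
    and ab: "a2 * b3 - a3 * b2 \<noteq> 0 \<or> a3 * b1 - a1 * b3 \<noteq> 0 \<or> a1 * b2 - a2 * b1 \<noteq> 0"
  shows "v1 = 0" "v2 = 0" "v3 = 0"
proof -
  have *: "v * (a * b' - a' * b) = 0"
    if "v * a = u * c" "v * a' = u' * c" "u * b' = u' * b" for v a b a' b' u u' c :: 'a
  proof -
    have "v * (a * b' - a' * b) = (v * a) * b' - (v * a') * b" by (simp add: algebra_simps)
    also have "\<dots> = c * (u * b' - u' * b)" unfolding that(1,2) by (simp add: algebra_simps)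
    finally show ?thesis using that(3) by simp
  qed
  show "v1 = 0" using *[of v1 a2 v2 a1 a3 v3 b3 b2] *[of v1 a3 v3 a1 a1 v1 b1 b3] *[of v1 a1 v1 a1 a2 v2 b2 b1]
      va vb ab by auto
  show "v2 = 0" using *[of v2 a2 v2 a2 a3 v3 b3 b2] *[of v2 a3 v3 a2 a1 v1 b1 b3] *[of v2 a1 v1 a2 a2 v2 b2 b1]
      va vb ab by auto
  show "v3 = 0" using *[of v3 a2 v2 a3 a3 v3 b3 b2] *[of v3 a3 v3 a3 a1 v1 b1 b3] *[of v3 a1 v1 a3 a2 v2 b2 b1]
      va vb ab by auto
qed

text \<open>The key step of Saito's criterion: for a syzygy \<open>w\<close> the cross products of \<open>w\<close> with \<open>a\<close>
  and with \<open>b\<close> are, like \<open>a \<times> b\<close>, parallel to the gradient, whose entries are coprime; the two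
  proportionality factors are the coordinates of \<open>w\<close>.\<close>

lemma syzygy_in_span:
  fixes a1 a2 a3 b1 b2 b3 g1 g2 g3 w1 w2 w3 :: poly3
  assumes c: "c \<noteq> 0"
    and cross: "a2 * b3 - a3 * b2 = cnst c * g1" "a3 * b1 - a1 * b3 = cnst c * g2"
      "a1 * b2 - a2 * b1 = cnst c * g3"
    and cop: "\<And>p. prime_elem p \<Longrightarrow> p dvd g1 \<Longrightarrow> p dvd g2 \<Longrightarrow> p dvd g3 \<Longrightarrow> False"
    and w: "g1 * w1 + g2 * w2 + g3 * w3 = 0"
  shows "\<exists>r s. w1 = a1 * r + b1 * s \<and> w2 = a2 * r + b2 * s \<and> w3 = a3 * r + b3 * s"
proof -
  let ?k = "cnst c" and ?k' = "cnst (1 / c)"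
  have kk: "?k * ?k' = 1" using c by (simp flip: cnst_simps(4))
  have ga: "?k * (g1 * a1 + g2 * a2 + g3 * a3) = 0"
    unfolding distrib_left mult.assoc[symmetric] cross[symmetric] by (simp add: algebra_simps)
  have gb: "?k * (g1 * b1 + g2 * b2 + g3 * b3) = 0"
    unfolding distrib_left mult.assoc[symmetric] cross[symmetric] by (simp add: algebra_simps)
  from ga gb c have ga: "g1 * a1 + g2 * a2 + g3 * a3 = 0" and gb: "g1 * b1 + g2 * b2 + g3 * b3 = 0"
    by simp_all
  \<comment> \<open>Both w and t are orthogonal to g, so w x t is parallel to g; the differences
    below are, up to sign, the entries of (w x t) x g = (w.g) t - (t.g) w.\<close>
  have par: "\<exists>r. w2 * t3 - w3 * t2 = r * g1 \<and> w3 * t1 - w1 * t3 = r * g2 \<and> w1 * t2 - w2 * t1 = r * g3"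
    if t: "g1 * t1 + g2 * t2 + g3 * t3 = 0" for t1 t2 t3
  proof (rule parallel_imp_multiple'[OF _ _ _ cop])
    have "(w2 * t3 - w3 * t2) * g2 - (w3 * t1 - w1 * t3) * g1 =
        t3 * (g1 * w1 + g2 * w2 + g3 * w3) - w3 * (g1 * t1 + g2 * t2 + g3 * t3)"
      by (simp add: algebra_simps)
    then show "(w2 * t3 - w3 * t2) * g2 = (w3 * t1 - w1 * t3) * g1" using w t by simp
    have "(w2 * t3 - w3 * t2) * g3 - (w1 * t2 - w2 * t1) * g1 =
        w2 * (g1 * t1 + g2 * t2 + g3 * t3) - t2 * (g1 * w1 + g2 * w2 + g3 * w3)"
      by (simp add: algebra_simps)
    then show "(w2 * t3 - w3 * t2) * g3 = (w1 * t2 - w2 * t1) * g1" using w t by simp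
    have "(w3 * t1 - w1 * t3) * g3 - (w1 * t2 - w2 * t1) * g2 =
        t1 * (g1 * w1 + g2 * w2 + g3 * w3) - w1 * (g1 * t1 + g2 * t2 + g3 * t3)"
      by (simp add: algebra_simps)
    then show "(w3 * t1 - w1 * t3) * g3 = (w1 * t2 - w2 * t1) * g2" using w t by simp
  qed
  from par[OF gb] obtain r where
    r: "w2 * b3 - w3 * b2 = r * g1" "w3 * b1 - w1 * b3 = r * g2" "w1 * b2 - w2 * b1 = r * g3"
    by blast
  from par[OF ga] obtain s where
    s: "w2 * a3 - w3 * a2 = s * g1" "w3 * a1 - w1 * a3 = s * g2" "w1 * a2 - w2 * a1 = s * g3"
    by blast
  have g0: "g1 \<noteq> 0 \<or> g2 \<noteq> 0 \<or> g3 \<noteq> 0"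
    using cop[of varX] by (auto simp: varX_def prime_elem_linear_poly)
  have k0: "?k \<noteq> 0" using c by simp
  have kr: "?k * (w2 * b3 - w3 * b2) = r * (a2 * b3 - a3 * b2)"
       "?k * (w3 * b1 - w1 * b3) = r * (a3 * b1 - a1 * b3)"
       "?k * (w1 * b2 - w2 * b1) = r * (a1 * b2 - a2 * b1)"
    unfolding r cross by simp_all
  have ks: "?k * (w2 * a3 - w3 * a2) = s * (a2 * b3 - a3 * b2)"
       "?k * (w3 * a1 - w1 * a3) = s * (a3 * b1 - a1 * b3)"
       "?k * (w1 * a2 - w2 * a1) = s * (a1 * b2 - a2 * b1)"
    unfolding s cross by simp_all
  have ab: "a2 * b3 - a3 * b2 \<noteq> 0 \<or> a3 * b1 - a1 * b3 \<noteq> 0 \<or> a1 * b2 - a2 * b1 \<noteq> 0"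
    unfolding cross using g0 k0 by simp
  \<comment> \<open>Because w x b = r g, w x a = s g and a x b = c g, the vector v = c w - r a + s b
    has zero cross product with both a and b.\<close>
  define v1 v2 v3 where v: "v1 = ?k * w1 - a1 * r + b1 * s" "v2 = ?k * w2 - a2 * r + b2 * s"
    "v3 = ?k * w3 - a3 * r + b3 * s"
  have va: "v1 * a2 = v2 * a1" "v1 * a3 = v3 * a1" "v2 * a3 = v3 * a2"
    using ks unfolding v by (simp_all add: algebra_simps)
  have vb: "v1 * b2 = v2 * b1" "v1 * b3 = v3 * b1" "v2 * b3 = v3 * b2"
    using kr unfolding v by (simp_all add: algebra_simps)
  have "v1 = 0" "v2 = 0" "v3 = 0"
    using cross_zero_imp_zero[OF va vb ab] by simp_all
  then have "?k * w1 = a1 * r - b1 * s" "?k * w2 = a2 * r - b2 * s" "?k * w3 = a3 * r - b3 * s"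
    unfolding v by (simp_all add: algebra_simps eq_diff_eq)
  then have "?k' * (?k * w1) = ?k' * (a1 * r - b1 * s)" "?k' * (?k * w2) = ?k' * (a2 * r - b2 * s)"
    "?k' * (?k * w3) = ?k' * (a3 * r - b3 * s)" by simp_all
  then have "w1 = a1 * (?k' * r) + b1 * (- ?k' * s)" "w2 = a2 * (?k' * r) + b2 * (- ?k' * s)"
      "w3 = a3 * (?k' * r) + b3 * (- ?k' * s)"
    using kk by (simp_all add: algebra_simps flip: mult.assoc)
  then show ?thesis by blast
qed

text \<open>The hypothesis \<open>cross\<close> is the Hilbert-Burch description of the gradient: a
  and b generate all syzygies, and they are independent because their cross product is
  nonzero.\<close>

lemma free_with_exponents_crossI:
  assumes hom: "homogeneous (int d) f" and sf: "squarefree f" and f0: "f \<noteq> 0"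
    and a: "homogeneous (int d1) a1" "homogeneous (int d1) a2" "homogeneous (int d1) a3"
    and b: "homogeneous (int d2) b1" "homogeneous (int d2) b2" "homogeneous (int d2) b3"
    and c: "c \<noteq> 0"
    and cross: "a2 * b3 - a3 * b2 = cnst c * dX f" "a3 * b1 - a1 * b3 = cnst c * dY f"
      "a1 * b2 - a2 * b1 = cnst c * dZ f"
    and d: "1 \<le> d1" "d1 \<le> d2" "d1 + d2 + 1 = d"
  shows "free_with_exponents f d1 d2"
proof -
  have d0: "d > 0" using d by simp
  note cop = squarefree_imp_coprime_partials[OF hom d0 sf]
  let ?M1 = "mat_of_rows_list 3 [[dX f, dY f, dZ f]]"
  let ?M2 = "mat_of_rows_list 2 [[a1, b1], [a2, b2], [a3, b3]]"
  \<comment> \<open>No columns: a free curve has m = 2, hence no numbers e_i.\<close>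
  let ?M3 = "0\<^sub>m 2 0 :: poly3 mat"
  have lt: "i < 3 \<longleftrightarrow> i = 0 \<or> i = 1 \<or> i = 2" "i < 2 \<longleftrightarrow> i = 0 \<or> i = 1" "i < 1 \<longleftrightarrow> i = 0" for i :: nat
    by auto
  have M1v: "?M1 *\<^sub>v v = vec 1 (\<lambda>_. dX f * v $ 0 + dY f * v $ 1 + dZ f * v $ 2)"
    if "v \<in> carrier_vec 3" for v
    using that by (intro eq_vecI) (auto simp: scalar_prod_def mat_of_rows_list_def numeral_3_eq_3 numeral_2_eq_2)
  have M2v: "?M2 *\<^sub>v v = vec 3 (\<lambda>i. [a1, a2, a3] ! i * v $ 0 + [b1, b2, b3] ! i * v $ 1)"
    if "v \<in> carrier_vec 2" for v
    using that by (intro eq_vecI) (auto simp: scalar_prod_def mat_of_rows_list_def lt numeral_2_eq_2 numeral_3_eq_3 less_Suc_eq)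
  have dims: "dim_col ?M1 = 3" "dim_row ?M1 = 1" "dim_col ?M2 = 2" "dim_row ?M2 = 3"
    by (simp_all add: mat_of_rows_list_def)
  \<comment> \<open>Minimality is only a matter of degrees: every entry of the matrices is a form of
    positive degree.\<close>
  have hom0: "coeff3 p 0 0 0 = 0" if "homogeneous e p" "e \<noteq> 0" for e p
    using that unfolding homogeneous_def by force
  have image1: "mat_image ?M1 = {v \<in> carrier_vec 1. v $ 0 \<in> jacobian_ideal f}"
  proof (intro equalityI subsetI)
    fix v assume "v \<in> mat_image ?M1"
    then obtain w where "w \<in> carrier_vec 3" "v = ?M1 *\<^sub>v w" by (auto simp: mat_image_def dims)
    then have "v \<in> carrier_vec 1" "v $ 0 = w $ 0 * dX f + w $ 1 * dY f + w $ 2 * dZ f"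
      by (simp_all add: M1v mult.commute)
    then show "v \<in> {v \<in> carrier_vec 1. v $ 0 \<in> jacobian_ideal f}"
      unfolding jacobian_ideal_def by blast
  next
    fix v :: "poly3 vec" assume "v \<in> {v \<in> carrier_vec 1. v $ 0 \<in> jacobian_ideal f}"
    then obtain p q r where v: "v \<in> carrier_vec 1" "v $ 0 = p * dX f + q * dY f + r * dZ f"
      by (auto simp: jacobian_ideal_def)
    let ?w = "vec_of_list [p, q, r]"
    have w: "?w \<in> carrier_vec 3" by (rule carrier_vecI) simp
    have "v = ?M1 *\<^sub>v ?w"
      unfolding M1v[OF w] using v
      by (intro eq_vecI) (simp_all add: mult.commute vec_of_list_index numeral_2_eq_2)
    with w show "v \<in> mat_image ?M1" unfolding mat_image_def dims by blast
  qed
  have ga: "dX f * a1 + dY f * a2 + dZ f * a3 = 0"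
  proof -
    have "cnst c * (dX f * a1 + dY f * a2 + dZ f * a3) = 0"
      unfolding distrib_left mult.assoc[symmetric] cross[symmetric] by (simp add: algebra_simps)
    with c show ?thesis by simp
  qed
  have gb: "dX f * b1 + dY f * b2 + dZ f * b3 = 0"
  proof -
    have "cnst c * (dX f * b1 + dY f * b2 + dZ f * b3) = 0"
      unfolding distrib_left mult.assoc[symmetric] cross[symmetric] by (simp add: algebra_simps)
    with c show ?thesis by simp
  qed
  have kernel1: "mat_kernel ?M1 = mat_image ?M2"
  proof (intro equalityI subsetI)
    fix w assume "w \<in> mat_kernel ?M1"
    then have w: "w \<in> carrier_vec 3" "?M1 *\<^sub>v w = 0\<^sub>v 1" by (auto simp: mat_kernel_def dims)
    then have "dX f * w $ 0 + dY f * w $ 1 + dZ f * w $ 2 = 0"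
      using arg_cong[OF M1v[OF w(1)], of "\<lambda>u. u $ 0"] by simp
    then have "\<exists>r s. w $ 0 = a1 * r + b1 * s \<and> w $ 1 = a2 * r + b2 * s \<and> w $ 2 = a3 * r + b3 * s"
      by (intro syzygy_in_span[OF c cross]) (auto dest: cop)
    then obtain r s where
      rs: "w $ 0 = a1 * r + b1 * s" "w $ 1 = a2 * r + b2 * s" "w $ 2 = a3 * r + b3 * s" by blast
    let ?v = "vec_of_list [r, s]"
    have v: "?v \<in> carrier_vec 2" by (rule carrier_vecI) simp
    have "w = ?M2 *\<^sub>v ?v"
      unfolding M2v[OF v] using w(1) rs
      by (intro eq_vecI) (auto simp: lt vec_of_list_index carrier_vecD)
    with v show "w \<in> mat_image ?M2" unfolding mat_image_def dims by blast
  next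
    fix w assume "w \<in> mat_image ?M2"
    then obtain v where v: "v \<in> carrier_vec 2" "w = ?M2 *\<^sub>v v" by (auto simp: mat_image_def dims)
    then have w: "w \<in> carrier_vec 3" by (simp add: M2v)
    have "dX f * w $ 0 + dY f * w $ 1 + dZ f * w $ 2 =
        (dX f * a1 + dY f * a2 + dZ f * a3) * v $ 0 + (dX f * b1 + dY f * b2 + dZ f * b3) * v $ 1"
      unfolding v(2) M2v[OF v(1)] by (simp add: algebra_simps)
    also have "\<dots> = 0" by (simp add: ga gb)
    finally have "?M1 *\<^sub>v w = 0\<^sub>v 1" unfolding M1v[OF w] by (intro eq_vecI) auto
    with w show "w \<in> mat_kernel ?M1" by (simp add: mat_kernel_def dims)
  qed
  have "prime_elem varX" by (simp add: varX_def prime_elem_linear_poly)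
  then have "dX f \<noteq> 0 \<or> dY f \<noteq> 0 \<or> dZ f \<noteq> 0" using cop[of varX] by auto
  then have ab: "a2 * b3 - a3 * b2 \<noteq> 0 \<or> a3 * b1 - a1 * b3 \<noteq> 0 \<or> a1 * b2 - a2 * b1 \<noteq> 0"
    unfolding cross using c by simp
  have kernel2: "mat_kernel ?M2 = mat_image ?M3"
  proof (intro equalityI subsetI)
    fix v assume "v \<in> mat_kernel ?M2"
    then have v: "v \<in> carrier_vec 2" "?M2 *\<^sub>v v = 0\<^sub>v 3" by (auto simp: mat_kernel_def dims)
    have e: "[a1, a2, a3] ! i * v $ 0 + [b1, b2, b3] ! i * v $ 1 = 0" if "i < 3" for i
      using arg_cong[OF M2v[OF v(1)], of "\<lambda>u. u $ i"] v(2) that by simp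
    have e: "a1 * v $ 0 + b1 * v $ 1 = 0" "a2 * v $ 0 + b2 * v $ 1 = 0" "a3 * v $ 0 + b3 * v $ 1 = 0"
      using e[of 0] e[of 1] e[of 2] by simp_all
    have "v $ 0 * (p * q' - p' * q) = 0 \<and> v $ 1 * (p * q' - p' * q) = 0"
      if pq: "p * v $ 0 + q * v $ 1 = 0" "p' * v $ 0 + q' * v $ 1 = 0" for p q p' q'
    proof -
      have "v $ 0 * (p * q' - p' * q) = q' * (p * v $ 0 + q * v $ 1) - q * (p' * v $ 0 + q' * v $ 1)"
        "v $ 1 * (p * q' - p' * q) = p * (p' * v $ 0 + q' * v $ 1) - p' * (p * v $ 0 + q * v $ 1)"
        by (simp_all add: algebra_simps)
      with pq show ?thesis by simp
    qed
    from this[OF e(2,3)] this[OF e(3,1)] this[OF e(1,2)] ab have "v $ 0 = 0" "v $ 1 = 0"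
      by auto
    then have "v = ?M3 *\<^sub>v 0\<^sub>v 0" using v(1) by (intro eq_vecI) (auto simp: lt)
    then show "v \<in> mat_image ?M3" unfolding mat_image_def by auto
  next
    fix v :: "poly3 vec" assume "v \<in> mat_image ?M3"
    then have "v = 0\<^sub>v 2" by (auto simp: mat_image_def scalar_prod_def intro!: eq_vecI)
    then show "v \<in> mat_kernel ?M2" by (auto simp: mat_kernel_def dims M2v intro!: eq_vecI simp: lt)
  qed
  have kernel3: "mat_kernel ?M3 = {0\<^sub>v 0}"
    by (auto simp: mat_kernel_def intro!: eq_vecI)
  have g: "homogeneous (int d - 1) (dX f)" "homogeneous (int d - 1) (dY f)" "homogeneous (int d - 1) (dZ f)"
    using homogeneous_d[OF hom] by simp_all
  have graded: "graded_map (replicate 3 (1 - int d)) [0] ?M1"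
    "graded_map (map (\<lambda>k. 1 - int d - int k) [d1, d2]) (replicate 3 (1 - int d)) ?M2"
    "graded_map (map uminus []) (map (\<lambda>k. 1 - int d - int k) [d1, d2]) ?M3"
    using g a b by (auto simp: graded_map_def mat_of_rows_list_def less_Suc_eq numeral_2_eq_2
        numeral_3_eq_3 carrier_matI)
  have "coeff3 (dX f) 0 0 0 = 0" "coeff3 (dY f) 0 0 0 = 0" "coeff3 (dZ f) 0 0 0 = 0"
    "coeff3 a1 0 0 0 = 0" "coeff3 a2 0 0 0 = 0" "coeff3 a3 0 0 0 = 0"
    "coeff3 b1 0 0 0 = 0" "coeff3 b2 0 0 0 = 0" "coeff3 b3 0 0 0 = 0"
    using d by (auto intro!: hom0[OF g(1)] hom0[OF g(2)] hom0[OF g(3)] a[THEN hom0] b[THEN hom0])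
  then have minimal: "minimal_map ?M1" "minimal_map ?M2" "minimal_map ?M3"
    by (auto simp: minimal_map_def mat_of_rows_list_def less_Suc_eq numeral_2_eq_2 numeral_3_eq_3)
  have "minimal_graded_free_resolution (jacobian_ideal f) (replicate 3 (1 - int d))
      (map (\<lambda>k. 1 - int d - int k) [d1, d2]) (map uminus [])"
    unfolding minimal_graded_free_resolution_def
    by (rule exI[of _ ?M1], rule exI[of _ ?M2], rule exI[of _ ?M3])
       (use graded minimal image1 kernel1 kernel2 kernel3 in simp)
  then have "syzygy_curve 2 d [d1, d2] [] f"
    using hom sf f0 d by (simp add: syzygy_curve_def reduced_curve_def)
  then show ?thesis unfolding free_with_exponents_def using d by (intro exI[of _ d] exI[of _ "[]"]) simp
qed

section \<open>Conics and lines\<close>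

text \<open>The coefficient of x^2 is fixed to 1, so that these forms are normalized and can be
  members of a prime factorization.\<close>

definition conic :: "complex \<Rightarrow> complex \<Rightarrow> complex \<Rightarrow> complex \<Rightarrow> complex \<Rightarrow> poly3" where
  "conic a b c d e = varX^2 + cnst a * varX * varY + cnst b * varX * varZ + cnst c * varY * varZ
     + cnst d * varY^2 + cnst e * varZ^2"

lemma conic_pCons:
  "conic a b c d e = [:[:[:0, 0, e:], [:0, c:], [:d:]:], [:[:0, b:], [:a:]:], 1:]"
  by (simp add: conic_def cnst_def varX_def varY_def varZ_def power2_eq_square one_pCons)

lemma conic_eq_iff [simp]:
  "conic a b c d e = conic a' b' c' d' e' \<longleftrightarrow> a = a' \<and> b = b' \<and> c = c' \<and> d = d' \<and> e = e'"
  by (auto simp: conic_pCons)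

text \<open>\<open>prime\<close> includes being normalized, and in nested polynomial rings over a
  field the unit factor comes from the innermost leading coefficient. The order of the variables
  thus decides which multiple of a form belongs to an arrangement.\<close>

lemma prime_elem_imp_prime_poly3:
  fixes p :: poly3
  assumes "prime_elem p" "lead_coeff (lead_coeff (lead_coeff p)) = 1"
  shows "prime p"
proof -
  have "unit_factor p = 1"
    using assms(2) by (simp add: unit_factor_poly_def one_pCons)
  then have "normalize p = p"
    using unit_factor_mult_normalize[of p] by simp
  with assms(1) show ?thesis by (simp add: prime_def)
qed

lemma degree_le_1_poly:
  assumes "degree p \<le> 1" shows "p = [:coeff p 0, coeff p 1:]"
  using assms by (intro poly_eqI) (auto simp: coeff_pCons coeff_eq_0 split: nat.splits)

text \<open>With t = t0 + t1 y one has (2 t0 t1)^2 = 4 t0^2 t1^2: a binary quadratic form in y and z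
  that is a square has discriminant 0.\<close>

lemma square_eq_binary_quadratic:
  fixes t :: "complex poly poly"
  assumes "t * t = [:[:0, 0, r:], [:0, q:], [:p:]:]"
  shows "q\<^sup>2 = 4 * p * r"
proof -
  have "degree (t * t) \<le> 2" unfolding assms by (auto intro!: degree_pCons_le simp: degree_pCons_eq_if)
  then have "degree t \<le> 1" by (cases "t = 0") (auto simp: degree_mult_eq)
  then obtain t0 t1 where t: "t = [:t0, t1:]"
    by (meson degree_le_1_poly)
  have e: "t0 * t0 = [:0, 0, r:]" "t0 * t1 + t1 * t0 = [:0, q:]" "t1 * t1 = [:p:]"
    using assms unfolding t by (auto split: if_splits)
  have "(t0 * t1 + t1 * t0)\<^sup>2 = 4 * (t1 * t1) * (t0 * t0)"
    by (simp add: power2_eq_square algebra_simps)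
  then show ?thesis unfolding e
    by (simp add: power2_eq_square numeral_poly)
qed

text \<open>A factorization of a monic quadratic over \<open>\<complex>[z][y]\<close> would make its discriminant a square.\<close>

lemma prime_conic:
  assumes "4 * d * e + a * b * c - c\<^sup>2 - a\<^sup>2 * e - b\<^sup>2 * d \<noteq> 0"
  shows "prime (conic a b c d e)"
proof (rule prime_elem_imp_prime_poly3)
  let ?\<beta> = "[:[:0, b:], [:a:]:]" and ?\<gamma> = "[:[:0, 0, e:], [:0, c:], [:d:]:]"
  have q: "conic a b c d e = [:?\<gamma>, ?\<beta>, 1:]" by (rule conic_pCons)
  have "irreducible [:?\<gamma>, ?\<beta>, 1:]"
  proof (rule irreducibleI)
    show "\<not> is_unit [:?\<gamma>, ?\<beta>, 1:]" by (auto simp: is_unit_poly_iff)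
  next
    fix u v assume uv: "[:?\<gamma>, ?\<beta>, 1:] = u * v"
    have unit: "is_unit w" if "w * w' = [:?\<gamma>, ?\<beta>, 1:]" "degree w = 0" for w w'
    proof -
      from that(2) obtain w0 where w: "w = [:w0:]" by (rule degree_eq_zeroE)
      have "w0 * coeff w' 2 = 1"
        using arg_cong[OF that(1), of "\<lambda>p. coeff p 2"] by (simp add: w numeral_2_eq_2)
      then show ?thesis by (metis w dvdI is_unit_const_poly_iff)
    qed
    have nz: "u \<noteq> 0" "v \<noteq> 0" using uv by auto
    have "degree u + degree v = 2" using nz arg_cong[OF uv, of degree] by (simp add: degree_mult_eq)
    show "is_unit u \<or> is_unit v"
    proof (rule ccontr)
      assume "\<not> (is_unit u \<or> is_unit v)"
      then have "degree u \<noteq> 0" "degree v \<noteq> 0" using unit[of u v] unit[of v u] uv by (auto simp: mult.commute)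
      with \<open>degree u + degree v = 2\<close> have "degree u = 1" "degree v = 1" by auto
      then obtain u0 u1 v0 v1 where u: "u = [:u0, u1:]" and v: "v = [:v0, v1:]"
        using degree_le_1_poly[of u] degree_le_1_poly[of v] by auto
      have e: "u0 * v0 = ?\<gamma>" "u0 * v1 + u1 * v0 = ?\<beta>" "u1 * v1 = 1"
        using uv unfolding u v by (simp_all add: algebra_simps)
      \<comment> \<open>This is the discriminant with respect to x. As a binary quadratic in y and z
        its own discriminant is -16 times the quantity assumed nonzero, which is 4 times the
        determinant of the symmetric matrix of the conic.\<close>
      have "(u0 * v1 - u1 * v0) * (u0 * v1 - u1 * v0) = (u0 * v1 + u1 * v0)\<^sup>2 - 4 * (u0 * v0) * (u1 * v1)"
        by (simp add: power2_eq_square algebra_simps)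
      also have "\<dots> = [:[:0, 0, b\<^sup>2 - 4 * e:], [:0, 2 * a * b - 4 * c:], [:a\<^sup>2 - 4 * d:]:]"
        unfolding e by (simp add: power2_eq_square numeral_poly)
      finally have "(2 * a * b - 4 * c)\<^sup>2 = 4 * (a\<^sup>2 - 4 * d) * (b\<^sup>2 - 4 * e)"
        by (rule square_eq_binary_quadratic)
      then have "16 * (4 * d * e + a * b * c - c\<^sup>2 - a\<^sup>2 * e - b\<^sup>2 * d) = 0"
        by (simp add: power2_eq_square algebra_simps)
      with assms show False by (metis mult_eq_0_iff zero_neq_numeral)
    qed
  qed auto
  then show "prime_elem (conic a b c d e)"
    unfolding q by (rule irreducible_imp_prime_elem_gcd)
  show "lead_coeff (lead_coeff (lead_coeff (conic a b c d e))) = 1"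
    unfolding q by simp
qed

text \<open>The degrees of two factors add up to 1, so one factor is a constant dividing both
  coefficients. This serves for the lines and for the two coordinate conics that are linear in
  x.\<close>

lemma irreducible_linear_polyI:
  fixes m n :: "'a::{idom_divide, algebraic_semidom}"
  assumes "m \<noteq> 0" and cop: "\<And>d. d dvd m \<Longrightarrow> d dvd n \<Longrightarrow> is_unit d"
  shows "irreducible [:n, m:]"
proof (rule irreducibleI)
  show "[:n, m:] \<noteq> 0" "\<not> is_unit [:n, m:]" using \<open>m \<noteq> 0\<close> by (auto simp: is_unit_poly_iff)
  fix u v assume uv: "[:n, m:] = u * v"
  have unit: "is_unit w" if "w * w' = [:n, m:]" "degree w = 0" for w w'
  proof -
    from that(2) obtain d where w: "w = [:d:]" by (rule degree_eq_zeroE)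
    have "d * coeff w' 0 = n" "d * coeff w' 1 = m"
      using arg_cong[OF that(1), of "\<lambda>p. coeff p 0"] arg_cong[OF that(1), of "\<lambda>p. coeff p 1"]
      by (simp_all add: w)
    then show ?thesis using cop[of d] by (auto simp: w is_unit_const_poly_iff)
  qed
  have "u \<noteq> 0" "v \<noteq> 0" using uv \<open>m \<noteq> 0\<close> by auto
  then have "degree u + degree v = 1"
    using arg_cong[OF uv, of degree] \<open>m \<noteq> 0\<close> by (simp add: degree_mult_eq)
  then have "degree u = 0 \<or> degree v = 0" by arith
  then show "is_unit u \<or> is_unit v"
    using unit[of u v] unit[of v u] uv by (auto simp: mult.commute)
qed

definition line :: "complex \<Rightarrow> complex \<Rightarrow> poly3" where
  "line s t = varX + cnst s * varY + cnst t * varZ"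

lemma prime_line: "prime (line s t)"
proof (rule prime_elem_imp_prime_poly3)
  have q: "line s t = [:[:[:0, t:], [:s:]:], 1:]"
    by (simp add: line_def varX_def varY_def varZ_def cnst_def one_pCons)
  show "prime_elem (line s t)"
    unfolding q by (intro irreducible_imp_prime_elem_gcd irreducible_linear_polyI) auto
  show "lead_coeff (lead_coeff (lead_coeff (line s t))) = 1"
    unfolding q by simp
qed

lemma prime_varX: "prime varX"
  using prime_line[of 0 0] by (simp add: line_def)

lemma prime_varY: "prime varY"
  by (rule prime_elem_imp_prime_poly3) (simp_all add: varY_def prime_elem_const_poly_iff prime_elem_linear_poly)

lemma prime_varZ: "prime varZ"
  by (rule prime_elem_imp_prime_poly3) (simp_all add: varZ_def prime_elem_const_poly_iff prime_elem_linear_poly)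

lemma prime_xy_conic:
  assumes "l \<noteq> 0" shows "prime (varX * varY - cnst l * varZ^2)"
proof (rule prime_elem_imp_prime_poly3)
  have q: "varX * varY - cnst l * varZ^2 = [:[:[:0, 0, -l:]:], [:0, 1:]:]"
    by (simp add: varX_def varY_def varZ_def cnst_def power2_eq_square)
  have "is_unit d" if d: "d dvd [:0, 1:]" "d dvd [:[:0, 0, -l:]:]" for d :: "complex poly poly"
  proof -
    have "degree d = 0" using dvd_imp_degree_le[OF d(2)] assms by simp
    then obtain d0 where d0: "d = [:d0:]" by (rule degree_eq_zeroE)
    have "d0 dvd coeff [:0, 1:] 1" using d(1) unfolding d0 const_poly_dvd_iff by blast
    then have "d0 dvd 1" by simp
    then show ?thesis by (simp add: d0 is_unit_const_poly_iff)
  qed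
  then show "prime_elem (varX * varY - cnst l * varZ^2)"
    unfolding q by (intro irreducible_imp_prime_elem_gcd irreducible_linear_polyI) auto
  show "lead_coeff (lead_coeff (lead_coeff (varX * varY - cnst l * varZ^2))) = 1"
    unfolding q by simp
qed

lemma prime_xz_conic:
  assumes "l \<noteq> 0" shows "prime (varX * varZ - cnst l * varY^2)"
proof (rule prime_elem_imp_prime_poly3)
  have q: "varX * varZ - cnst l * varY^2 = [:[:0, 0, [:-l:]:], [:[:0, 1:]:]:]"
    by (simp add: varX_def varY_def varZ_def cnst_def power2_eq_square)
  have "is_unit d" if d: "d dvd [:[:0, 1:]:]" "d dvd [:0, 0, [:-l:]:]" for d :: "complex poly poly"
  proof -
    have "degree d = 0" using dvd_imp_degree_le[OF d(1)] by simp
    then obtain d0 where d0: "d = [:d0:]" by (rule degree_eq_zeroE)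
    have "d0 dvd coeff [:0, 0, [:-l:]:] 2" using d(2) unfolding d0 const_poly_dvd_iff by blast
    then have "d0 dvd [:-l:]" by (simp add: numeral_2_eq_2)
    moreover have "[:-l:] dvd 1" using assms by (simp add: is_unit_const_poly_iff dvd_field_iff)
    ultimately have "d0 dvd 1" by (rule dvd_trans)
    then show ?thesis by (simp add: d0 is_unit_const_poly_iff)
  qed
  then show "prime_elem (varX * varZ - cnst l * varY^2)"
    unfolding q by (intro irreducible_imp_prime_elem_gcd irreducible_linear_polyI) auto
  show "lead_coeff (lead_coeff (lead_coeff (varX * varZ - cnst l * varY^2))) = 1"
    unfolding q by simp
qed

lemma eval3_simps [simp]:
  "eval3 (p + q) u v w = eval3 p u v w + eval3 q u v w"
  "eval3 (p - q) u v w = eval3 p u v w - eval3 q u v w"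
  "eval3 (- p) u v w = - eval3 p u v w"
  "eval3 (p * q) u v w = eval3 p u v w * eval3 q u v w"
  "eval3 (cnst c) u v w = c"
  "eval3 (numeral n) u v w = numeral n"
  "eval3 varX u v w = u" "eval3 varY u v w = v" "eval3 varZ u v w = w"
  by (simp_all add: eval3_def cnst_def varX_def varY_def varZ_def)

text \<open>The rules for products and powers produce unevaluated degrees such as sums, which do not
  unify with a numeral; here the degree is left open, collected by the rules, and compared by
  \<open>simp\<close> at the end.\<close>

lemma homogeneous_cong: "homogeneous e p \<Longrightarrow> e = d \<Longrightarrow> homogeneous d p"
  by simp

lemma homogeneous_quadratic:
  "homogeneous 2 (cnst f * varX^2 + cnst a * varX * varY + cnst b * varX * varZ + cnst c * varY * varZ
     + cnst d * varY^2 + cnst e * varZ^2)"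
  by (intro homogeneous_add;
      rule homogeneous_cong, (rule homogeneous_mult homogeneous_power homogeneous_cnst homogeneous_var)+, simp)

lemma smooth_conic:
  assumes "4 * d * e + a * b * c - c\<^sup>2 - a\<^sup>2 * e - b\<^sup>2 * d \<noteq> 0"
  shows "is_smooth_conic (conic a b c d e)"
  unfolding is_smooth_conic_def
proof (intro conjI notI)
  show "homogeneous 2 (conic a b c d e)"
    using homogeneous_quadratic[of 1 a b c d e] by (simp add: conic_def)
  show "conic a b c d e = 0 \<Longrightarrow> False" by (simp add: conic_pCons)
  assume "\<exists>u v w. (u, v, w) \<noteq> (0, 0, 0) \<and> eval3 (conic a b c d e) u v w = 0 \<and>
    eval3 (dX (conic a b c d e)) u v w = 0 \<and> eval3 (dY (conic a b c d e)) u v w = 0 \<and>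
    eval3 (dZ (conic a b c d e)) u v w = 0"
  then obtain u v w where nz: "(u, v, w) \<noteq> (0, 0, 0)"
    and g: "eval3 (dX (conic a b c d e)) u v w = 0" "eval3 (dY (conic a b c d e)) u v w = 0"
      "eval3 (dZ (conic a b c d e)) u v w = 0" by blast
  have e1: "2 * u + a * v + b * w = 0"
    using g(1) by (simp add: conic_def dX_mult power2_eq_square algebra_simps)
  have e2: "a * u + 2 * d * v + c * w = 0"
    using g(2) by (simp add: conic_def dY_mult power2_eq_square algebra_simps)
  have e3: "b * u + c * v + 2 * e * w = 0"
    using g(3) by (simp add: conic_def dZ_mult power2_eq_square algebra_simps)
  define \<Delta> where "\<Delta> = 4 * d * e + a * b * c - c\<^sup>2 - a\<^sup>2 * e - b\<^sup>2 * d"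
  \<comment> \<open>The gradient vanishes on the kernel of the symmetric matrix with determinant 2
    \<Delta>; the multipliers here and below are the rows of its adjugate.\<close>
  have "2 * \<Delta> * u = (4 * d * e - c\<^sup>2) * (2 * u + a * v + b * w)
      + (b * c - 2 * a * e) * (a * u + 2 * d * v + c * w) + (a * c - 2 * b * d) * (b * u + c * v + 2 * e * w)"
    by (simp add: \<Delta>_def power2_eq_square algebra_simps)
  moreover have "2 * \<Delta> * v = (b * c - 2 * a * e) * (2 * u + a * v + b * w)
      + (4 * e - b\<^sup>2) * (a * u + 2 * d * v + c * w) + (a * b - 2 * c) * (b * u + c * v + 2 * e * w)"
    by (simp add: \<Delta>_def power2_eq_square algebra_simps)
  moreover have "2 * \<Delta> * w = (a * c - 2 * b * d) * (2 * u + a * v + b * w)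
      + (a * b - 2 * c) * (a * u + 2 * d * v + c * w) + (4 * d - a\<^sup>2) * (b * u + c * v + 2 * e * w)"
    by (simp add: \<Delta>_def power2_eq_square algebra_simps)
  ultimately have "2 * \<Delta> * u = 0" "2 * \<Delta> * v = 0" "2 * \<Delta> * w = 0"
    unfolding e1 e2 e3 by simp_all
  with assms nz show False by (simp add: \<Delta>_def[symmetric])
qed

lemma smooth_xy_conic:
  assumes "l \<noteq> 0" shows "is_smooth_conic (varX * varY - cnst l * varZ^2)"
proof -
  have "homogeneous 2 (varX * varY - cnst l * varZ^2)"
    using homogeneous_quadratic[of 0 1 0 0 0 "-l"] by simp
  moreover have "varX * varY - cnst l * varZ^2 \<noteq> 0"
    using prime_xy_conic[OF assms] by auto
  ultimately show ?thesis
    using assms by (auto simp: is_smooth_conic_def dX_mult dY_mult dZ_mult power2_eq_square)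
qed

lemma smooth_xz_conic:
  assumes "l \<noteq> 0" shows "is_smooth_conic (varX * varZ - cnst l * varY^2)"
proof -
  have "homogeneous 2 (varX * varZ - cnst l * varY^2)"
    using homogeneous_quadratic[of 0 0 1 0 "-l" 0] by simp
  moreover have "varX * varZ - cnst l * varY^2 \<noteq> 0"
    using prime_xz_conic[OF assms] by auto
  ultimately show ?thesis
    using assms by (auto simp: is_smooth_conic_def dX_mult dY_mult dZ_mult power2_eq_square)
qed

lemma line_is_line: "is_line (line s t)"
proof -
  have "homogeneous 1 (line s t)"
    unfolding line_def
    by (intro homogeneous_add;
        rule homogeneous_cong, (rule homogeneous_mult homogeneous_cnst homogeneous_var)+, simp)
  then show ?thesis using prime_line[of s t] by (auto simp: is_line_def)
qed

lemma homogeneous_unique: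
  assumes "homogeneous d p" "homogeneous e p" "p \<noteq> 0"
  shows "d = e"
proof -
  obtain i j k where "coeff3 p i j k \<noteq> 0"
    using poly3_eqI[of p 0] assms(3) by auto
  with assms(1,2) show ?thesis unfolding homogeneous_def by blast
qed

lemma line_not_smooth_conic: "is_line q \<Longrightarrow> \<not> is_smooth_conic q"
  using homogeneous_unique[of 1 q 2] by (auto simp: is_line_def is_smooth_conic_def)

section \<open>Free curves in a pencil of sextics\<close>

definition along :: "poly3 \<Rightarrow> poly3 \<Rightarrow> poly3 \<Rightarrow> poly3 \<Rightarrow> poly3" where
  "along t1 t2 t3 g = t1 * dX g + t2 * dY g + t3 * dZ g"

lemma along_simps:
  "along t1 t2 t3 (g + h) = along t1 t2 t3 g + along t1 t2 t3 h"
  "along t1 t2 t3 (g - h) = along t1 t2 t3 g - along t1 t2 t3 h"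
  "along t1 t2 t3 (g * h) = g * along t1 t2 t3 h + along t1 t2 t3 g * h"
  "along t1 t2 t3 (g\<^sup>2) = 2 * g * along t1 t2 t3 g"
  "along t1 t2 t3 (cnst c) = 0"
  "along t1 t2 t3 (numeral n) = 0"
  by (simp_all add: along_def dX_mult dY_mult dZ_mult power2_eq_square algebra_simps)

text \<open>The first syzygy is grad E x grad H, of degree 2 + 5; its cross product with t is the
  left side of \<open>grad\<close>.\<close>

lemma free_pencil:
  assumes E: "homogeneous 3 E" and H: "homogeneous 6 H"
    and hom: "homogeneous (int d) f" and sf: "squarefree f" and c: "c \<noteq> 0"
    and t: "homogeneous (int n) t1" "homogeneous (int n) t2" "homogeneous (int n) t3"
    and grad: "dX H * along t1 t2 t3 E - dX E * along t1 t2 t3 H = cnst c * dX f"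
      "dY H * along t1 t2 t3 E - dY E * along t1 t2 t3 H = cnst c * dY f"
      "dZ H * along t1 t2 t3 E - dZ E * along t1 t2 t3 H = cnst c * dZ f"
    and n: "7 \<le> n" "7 + n + 1 = d"
  shows "free_with_exponents f 7 n"
proof (rule free_with_exponents_crossI[OF hom sf _ _ _ _ t c])
  show "f \<noteq> 0" using sf by auto
  note EH = homogeneous_d[OF E] homogeneous_d[OF H]
  show "homogeneous (int 7) (dY E * dZ H - dZ E * dY H)" "homogeneous (int 7) (dZ E * dX H - dX E * dZ H)"
    "homogeneous (int 7) (dX E * dY H - dY E * dX H)"
    by (intro homogeneous_diff; rule homogeneous_cong, rule homogeneous_mult, (rule EH)+, simp)+
  show "(dZ E * dX H - dX E * dZ H) * t3 - (dX E * dY H - dY E * dX H) * t2 = cnst c * dX f"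
    "(dX E * dY H - dY E * dX H) * t1 - (dY E * dZ H - dZ E * dY H) * t3 = cnst c * dY f"
    "(dY E * dZ H - dZ E * dY H) * t2 - (dZ E * dX H - dX E * dZ H) * t1 = cnst c * dZ f"
    unfolding grad[symmetric] by (simp_all add: along_def algebra_simps)
qed (use n in auto)

lemma d_cnst_mult:
  "dX (cnst c * g) = cnst c * dX g" "dY (cnst c * g) = cnst c * dY g" "dZ (cnst c * g) = cnst c * dZ g"
  by (simp_all add: dX_mult dY_mult dZ_mult)

text \<open>The given t is not yet a syzygy: it sends f to - 3 m H^2 f. The Euler derivation
  multiplies f by 21, so 7 t plus m H^2 times Euler kills f.\<close>

lemma free_pencil_cubic_sextics:
  assumes E: "homogeneous 3 E" and H: "homogeneous 6 H"
    and f: "f = cnst c * (E * (cnst e * E ^ 6 - H ^ 3))" "c \<noteq> 0" and sf: "squarefree f"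
    and t: "homogeneous 13 t1" "homogeneous 13 t2" "homogeneous 13 t3"
    and tE: "along t1 t2 t3 E = 0" and tH: "along t1 t2 t3 H = cnst m * (cnst e * E ^ 6 - H ^ 3)"
    and m: "m \<noteq> 0"
  shows "free_with_exponents f 7 13"
proof -
  define u1 u2 u3 where u: "u1 = 7 * t1 + cnst m * H\<^sup>2 * varX" "u2 = 7 * t2 + cnst m * H\<^sup>2 * varY"
    "u3 = 7 * t3 + cnst m * H\<^sup>2 * varZ"
  have al: "along u1 u2 u3 g = 7 * along t1 t2 t3 g + cnst m * H\<^sup>2 * (varX * dX g + varY * dY g + varZ * dZ g)" for g
    by (simp add: u along_def algebra_simps)
  have uE: "along u1 u2 u3 E = 3 * cnst m * E * H\<^sup>2"
    unfolding al tE using euler_homogeneous[of 3 E] E by (simp add: algebra_simps)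
  have uH: "along u1 u2 u3 H = cnst m * (7 * cnst e * E ^ 6 - H ^ 3)"
    unfolding al tH using euler_homogeneous[of 6 H] H
    by (simp add: power2_eq_square power3_eq_cube algebra_simps)
  have hu: "homogeneous (int 13) u1" "homogeneous (int 13) u2" "homogeneous (int 13) u3"
    unfolding u
    by (intro homogeneous_add; rule homogeneous_cong,
        (rule homogeneous_mult homogeneous_power homogeneous_cnst homogeneous_numeral H homogeneous_var t)+, simp)+
  have hf: "homogeneous (int 21) f"
    unfolding f right_diff_distrib
    by (intro homogeneous_diff; rule homogeneous_cong,
        (rule homogeneous_mult homogeneous_power homogeneous_cnst H E)+, simp)
  have inv: "cnst (- m / c) * (cnst c * g) = - (cnst m * g)" for g
    using f(2) by (simp flip: mult.assoc cnst_simps(4))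
  have p: "x ^ 6 = x * (x * (x * (x * (x * x))))" for x :: poly3 by (simp add: eval_nat_numeral)
  show ?thesis
  proof (rule free_pencil[OF E H hf sf _ hu])
    show "- m / c \<noteq> 0" using f(2) m by simp
  qed (unfold f(1) d_cnst_mult inv uE uH,
       auto simp: dX_mult dY_mult dZ_mult power2_eq_square power3_eq_cube p algebra_simps)
qed

text \<open>Without the factor E one has f_H = - 3 c H^2 and f_E = 6 c E^5, so t itself has the
  required images up to the constant -1/c and no Euler term is added.\<close>

lemma free_pencil_sextics:
  assumes E: "homogeneous 3 E" and H: "homogeneous 6 H"
    and f: "f = cnst c * (E ^ 6 - H ^ 3)" "c \<noteq> 0" and sf: "squarefree f"
    and t: "homogeneous 10 t1" "homogeneous 10 t2" "homogeneous 10 t3"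
    and tE: "along t1 t2 t3 E = 3 * H\<^sup>2" and tH: "along t1 t2 t3 H = 6 * E ^ 5"
  shows "free_with_exponents f 7 10"
proof -
  have hf: "homogeneous (int 18) f"
    unfolding f right_diff_distrib
    by (intro homogeneous_diff; rule homogeneous_cong,
        (rule homogeneous_mult homogeneous_power homogeneous_cnst H E)+, simp)
  have inv: "cnst (- 1 / c) * (cnst c * g) = - g" for g
    using f(2) by (simp flip: mult.assoc cnst_simps(4))
  have p: "x ^ 6 = x * (x * (x * (x * (x * x))))" "x ^ 5 = x * (x * (x * (x * x)))"
    for x :: poly3 by (simp_all add: eval_nat_numeral)
  have ht: "homogeneous (int 10) t1" "homogeneous (int 10) t2" "homogeneous (int 10) t3"
    using t by simp_all
  show ?thesis
  proof (rule free_pencil[OF E H hf sf _ ht])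
    show "- 1 / c \<noteq> 0" using f(2) by simp
  qed (unfold f(1) d_cnst_mult inv tE tH,
       auto simp: dX_mult dY_mult dZ_mult power2_eq_square power3_eq_cube p algebra_simps)
qed

section \<open>Symmetric invariants and the derivations built from them\<close>

definition symA :: poly3 where "symA = varX ^ 3 + varY ^ 3 + varZ ^ 3"
definition symB :: poly3 where "symB = varX * varY * varZ"
definition symC :: poly3 where "symC = (varX * varY) ^ 3 + (varY * varZ) ^ 3 + (varZ * varX) ^ 3"

lemma homogeneous_sym:
  "homogeneous 3 symA" "homogeneous 3 symB" "homogeneous 3 (cnst k * symB)" "homogeneous 6 symC"
  unfolding symA_def symB_def symC_def
  by ((intro homogeneous_add)?; rule homogeneous_cong,
      (rule homogeneous_mult homogeneous_power homogeneous_var homogeneous_cnst)+, simp)+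

text \<open>The factor \<open>k\<^sup>2\<close> of the third generator makes the formulas independent of \<open>k\<close> once they are written
  in terms of \<open>k B\<close>.\<close>

lemma invariant_derivation:
  assumes k: "k ^ 3 = 1"
    and p: "homogeneous (int n + 3) p" and q: "homogeneous (int n) q" and r: "homogeneous (int n) r"
  obtains t1 t2 t3 where
    "homogeneous (int n + 4) t1" "homogeneous (int n + 4) t2" "homogeneous (int n + 4) t3"
    "along t1 t2 t3 symA = 3 * p * symA + 3 * q * (symA\<^sup>2 - 2 * symC) + 9 * r * (cnst k * symB)\<^sup>2"
    "along t1 t2 t3 (cnst k * symB) = 3 * p * (cnst k * symB) + q * symA * (cnst k * symB) + r * symC"
    "along t1 t2 t3 symC = 6 * p * symC + 3 * q * (symA * symC - 3 * (cnst k * symB) ^ 3)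
       + 6 * r * symA * (cnst k * symB)\<^sup>2"
proof
  let ?K = "cnst k"
  let ?t1 = "p * varX + q * varX ^ 4 + (?K\<^sup>2 * r) * (varY * varZ)\<^sup>2"
  let ?t2 = "p * varY + q * varY ^ 4 + (?K\<^sup>2 * r) * (varZ * varX)\<^sup>2"
  let ?t3 = "p * varZ + q * varZ ^ 4 + (?K\<^sup>2 * r) * (varX * varY)\<^sup>2"
  have K: "?K ^ 3 = 1" using k by (metis cnst_power cnst_simps(2))
  show "homogeneous (int n + 4) ?t1" "homogeneous (int n + 4) ?t2" "homogeneous (int n + 4) ?t3"
    by (intro homogeneous_add; rule homogeneous_cong,
        (rule homogeneous_mult homogeneous_power homogeneous_var homogeneous_cnst p q r)+, simp)+
  show "along ?t1 ?t2 ?t3 symA = 3 * p * symA + 3 * q * (symA\<^sup>2 - 2 * symC) + 9 * r * (?K * symB)\<^sup>2"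
    by (simp add: along_def symA_def symB_def symC_def dX_mult dY_mult dZ_mult eval_nat_numeral algebra_simps)
  have "along ?t1 ?t2 ?t3 (?K * symB) = 3 * p * (?K * symB) + q * symA * (?K * symB) + ?K ^ 3 * (r * symC)"
    by (simp add: along_def symA_def symB_def symC_def dX_mult dY_mult dZ_mult eval_nat_numeral algebra_simps)
  then show "along ?t1 ?t2 ?t3 (?K * symB) = 3 * p * (?K * symB) + q * symA * (?K * symB) + r * symC"
    by (simp add: K)
  have "along ?t1 ?t2 ?t3 symC = 6 * p * symC + 3 * q * (symA * symC - 3 * symB ^ 3)
       + 6 * r * symA * (?K * symB)\<^sup>2"
    by (simp add: along_def symA_def symB_def symC_def dX_mult dY_mult dZ_mult eval_nat_numeral algebra_simps)
  then show "along ?t1 ?t2 ?t3 symC = 6 * p * symC + 3 * q * (symA * symC - 3 * (?K * symB) ^ 3)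
       + 6 * r * symA * (?K * symB)\<^sup>2"
    by (simp add: K power_mult_distrib)
qed

text \<open>Here \<open>dA\<close>, \<open>dB\<close>, \<open>dC\<close> are the images of the invariants under the derivation of
  \<open>invariant_derivation\<close> with coefficients \<open>p\<close>, \<open>q\<close>, \<open>r\<close>. The coefficients solve the linear system that
  prescribes the images of the cubic \<open>E\<close> and of the sextic \<open>H\<close>. The three cases belong to
  \<open>\<lambda> = 0\<close>, \<open>\<lambda>\<^sup>3 = 1\<close> and \<open>\<lambda>\<^sup>3 = - 8\<close>.\<close>

lemma sextic_derivation_0:
  fixes A B C :: "'a::comm_ring_1"
  defines "p \<equiv> A ^ 4 + 4 * A\<^sup>2 * C + 3 * A * B ^ 3 - 32 * C\<^sup>2"
    and "q \<equiv> 12 * A * C - 3 * A ^ 3 - 9 * B ^ 3"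
    and "r \<equiv> 96 * B * C - 24 * A\<^sup>2 * B"
  defines "dA \<equiv> 3 * p * A + 3 * q * (A\<^sup>2 - 2 * C) + 9 * r * B\<^sup>2"
    and "dB \<equiv> 3 * p * B + q * A * B + r * C"
    and "dC \<equiv> 6 * p * C + 3 * q * (A * C - 3 * B ^ 3) + 6 * r * A * B\<^sup>2"
  shows "dB = 0" "4 * dC - 2 * A * dA = 12 * (27 * B ^ 6 - (4 * C - A\<^sup>2) ^ 3)"
  unfolding assms by (simp_all add: eval_nat_numeral algebra_simps)

lemma sextic_derivation_1:
  fixes A B C :: "'a::comm_ring_1"
  defines "p \<equiv> 18 * A\<^sup>2 * B - 8 * A ^ 3 + 18 * A * C - 108 * B ^ 3"
    and "q \<equiv> 9 * A\<^sup>2 - 27 * A * B + 81 * B\<^sup>2 - 27 * C"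
    and "r \<equiv> 81 * A * B - 9 * A\<^sup>2 - 81 * B\<^sup>2 - 27 * C"
  defines "dA \<equiv> 3 * p * A + 3 * q * (A\<^sup>2 - 2 * C) + 9 * r * B\<^sup>2"
    and "dB \<equiv> 3 * p * B + q * A * B + r * C"
    and "dC \<equiv> 6 * p * C + 3 * q * (A * C - 3 * B ^ 3) + 6 * r * A * B\<^sup>2"
  shows "dA - 3 * dB = 3 * (A\<^sup>2 + 3 * A * B + 9 * B\<^sup>2 - 9 * C)\<^sup>2"
    "2 * A * dA + 3 * (A * dB + dA * B) + 18 * B * dB - 9 * dC = 6 * (A - 3 * B) ^ 5"
  unfolding assms by (simp_all add: eval_nat_numeral algebra_simps)

lemma sextic_derivation_2:
  fixes A B C :: "'a::comm_ring_1"
  defines "p \<equiv> 159 * A ^ 3 * B - 6 * A ^ 4 - 405 * A\<^sup>2 * B\<^sup>2 + 204 * A\<^sup>2 * C - 2619 * A * B ^ 3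
      - 1728 * A * B * C - 810 * B ^ 4 - 2160 * B\<^sup>2 * C - 864 * C\<^sup>2"
    and "q \<equiv> 6 * A ^ 3 - 171 * A\<^sup>2 * B + 675 * A * B\<^sup>2 - 180 * A * C + 2997 * B ^ 3 + 1512 * B * C"
    and "r \<equiv> 12 * A ^ 3 - 306 * A\<^sup>2 * B - 1350 * A * B\<^sup>2 - 504 * A * C - 810 * B ^ 3 - 432 * B * C"
  defines "dA \<equiv> 3 * p * A + 3 * q * (A\<^sup>2 - 2 * C) + 9 * r * B\<^sup>2"
    and "dB \<equiv> 3 * p * B + q * A * B + r * C"
    and "dC \<equiv> 6 * p * C + 3 * q * (A * C - 3 * B ^ 3) + 6 * r * A * B\<^sup>2"
  shows "dA - 3 * dB = 0"
    "2 * A * dA - 24 * (A * dB + dA * B) - 144 * B * dB - 36 * dC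
      = 4 * ((A - 3 * B) ^ 6 - (A\<^sup>2 - 24 * A * B - 72 * B\<^sup>2 - 36 * C) ^ 3)"
  unfolding assms by (simp_all add: eval_nat_numeral algebra_simps)

lemma free_sextics_0:
  assumes f: "f = cnst c * (symB * (27 * symB ^ 6 - (4 * symC - symA\<^sup>2) ^ 3))" "c \<noteq> 0"
    and sf: "squarefree f"
  shows "free_with_exponents f 7 13"
proof -
  let ?B = "cnst 1 * symB"
  let ?p = "symA ^ 4 + 4 * symA\<^sup>2 * symC + 3 * symA * ?B ^ 3 - 32 * symC\<^sup>2"
    and ?q = "12 * symA * symC - 3 * symA ^ 3 - 9 * ?B ^ 3"
    and ?r = "96 * ?B * symC - 24 * symA\<^sup>2 * ?B"
  have hom: "homogeneous (int 9 + 3) ?p" "homogeneous (int 9) ?q" "homogeneous (int 9) ?r"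
    by (intro homogeneous_add homogeneous_diff; rule homogeneous_cong,
        (rule homogeneous_mult homogeneous_power homogeneous_numeral homogeneous_cnst homogeneous_sym)+, simp)+
  obtain t1 t2 t3 where t: "homogeneous (int 9 + 4) t1" "homogeneous (int 9 + 4) t2" "homogeneous (int 9 + 4) t3"
    and A: "along t1 t2 t3 symA = 3 * ?p * symA + 3 * ?q * (symA\<^sup>2 - 2 * symC) + 9 * ?r * ?B\<^sup>2"
    and B: "along t1 t2 t3 ?B = 3 * ?p * ?B + ?q * symA * ?B + ?r * symC"
    and C: "along t1 t2 t3 symC = 6 * ?p * symC + 3 * ?q * (symA * symC - 3 * ?B ^ 3) + 6 * ?r * symA * ?B\<^sup>2"
    by (rule invariant_derivation[of 1, OF _ hom]) auto
  show ?thesis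
  proof (rule free_pencil_cubic_sextics)
    show "homogeneous 6 (4 * symC - symA\<^sup>2)"
      by (intro homogeneous_diff; rule homogeneous_cong,
          (rule homogeneous_mult homogeneous_power homogeneous_numeral homogeneous_sym)+, simp)
    show "f = cnst c * (?B * (cnst 27 * ?B ^ 6 - (4 * symC - symA\<^sup>2) ^ 3))" using f by simp
    show "along t1 t2 t3 ?B = 0" using sextic_derivation_0(1)[of symA symC ?B] B by simp
    have "along t1 t2 t3 (4 * symC - symA\<^sup>2) = 4 * along t1 t2 t3 symC - 2 * symA * along t1 t2 t3 symA"
      by (simp add: along_simps)
    also have "\<dots> = 12 * (27 * ?B ^ 6 - (4 * symC - symA\<^sup>2) ^ 3)"
      unfolding A C by (rule sextic_derivation_0(2))
    finally show "along t1 t2 t3 (4 * symC - symA\<^sup>2) = cnst 12 * (cnst 27 * ?B ^ 6 - (4 * symC - symA\<^sup>2) ^ 3)"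
      by simp
  qed (use t f sf in \<open>simp_all add: homogeneous_sym\<close>)
qed

text \<open>One derivation of degree 10 serves both curves: it is used as it stands for the conics
  alone, and multiplied by E and corrected by an Euler term once the lines are added.\<close>

lemma free_sextics_1:
  fixes k c :: complex
  defines "B \<equiv> cnst k * symB"
  defines "H \<equiv> symA\<^sup>2 + 3 * symA * B + 9 * B\<^sup>2 - 9 * symC"
  assumes k: "k ^ 3 = 1" and c: "c \<noteq> 0"
  shows "squarefree (cnst c * ((symA - 3 * B) ^ 6 - H ^ 3)) \<Longrightarrow>
      free_with_exponents (cnst c * ((symA - 3 * B) ^ 6 - H ^ 3)) 7 10"
    and "squarefree (cnst c * ((symA - 3 * B) * ((symA - 3 * B) ^ 6 - H ^ 3))) \<Longrightarrow>
      free_with_exponents (cnst c * ((symA - 3 * B) * ((symA - 3 * B) ^ 6 - H ^ 3))) 7 13"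
proof -
  let ?E = "symA - 3 * B"
  let ?p = "18 * symA\<^sup>2 * B - 8 * symA ^ 3 + 18 * symA * symC - 108 * B ^ 3"
    and ?q = "9 * symA\<^sup>2 - 27 * symA * B + 81 * B\<^sup>2 - 27 * symC"
    and ?r = "81 * symA * B - 9 * symA\<^sup>2 - 81 * B\<^sup>2 - 27 * symC"
  have hB: "homogeneous 3 B" unfolding B_def by (rule homogeneous_sym)
  have hom: "homogeneous (int 6 + 3) ?p" "homogeneous (int 6) ?q" "homogeneous (int 6) ?r"
    by (intro homogeneous_add homogeneous_diff; rule homogeneous_cong,
        (rule homogeneous_mult homogeneous_power homogeneous_numeral hB homogeneous_sym)+, simp)+
  obtain t1 t2 t3 where t: "homogeneous (int 6 + 4) t1" "homogeneous (int 6 + 4) t2" "homogeneous (int 6 + 4) t3"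
    and A: "along t1 t2 t3 symA = 3 * ?p * symA + 3 * ?q * (symA\<^sup>2 - 2 * symC) + 9 * ?r * B\<^sup>2"
    and B: "along t1 t2 t3 B = 3 * ?p * B + ?q * symA * B + ?r * symC"
    and C: "along t1 t2 t3 symC = 6 * ?p * symC + 3 * ?q * (symA * symC - 3 * B ^ 3) + 6 * ?r * symA * B\<^sup>2"
    unfolding B_def by (rule invariant_derivation[OF k hom[unfolded B_def]])
  have hE: "homogeneous 3 ?E"
    by (intro homogeneous_diff; rule homogeneous_cong,
        (rule homogeneous_mult homogeneous_numeral hB homogeneous_sym)+, simp)
  have hH: "homogeneous 6 H" unfolding H_def
    by (intro homogeneous_add homogeneous_diff; rule homogeneous_cong,
        (rule homogeneous_mult homogeneous_power homogeneous_numeral hB homogeneous_sym)+, simp)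
  have "along t1 t2 t3 ?E = along t1 t2 t3 symA - 3 * along t1 t2 t3 B"
    by (simp add: along_simps)
  also have "\<dots> = 3 * H\<^sup>2"
    unfolding A B H_def by (rule sextic_derivation_1(1))
  finally have tE: "along t1 t2 t3 ?E = 3 * H\<^sup>2" .
  have "along t1 t2 t3 H = 2 * symA * along t1 t2 t3 symA
      + 3 * (symA * along t1 t2 t3 B + along t1 t2 t3 symA * B)
      + 18 * B * along t1 t2 t3 B - 9 * along t1 t2 t3 symC"
    by (simp add: H_def along_simps algebra_simps)
  also have "\<dots> = 6 * ?E ^ 5"
    unfolding A B C by (rule sextic_derivation_1(2))
  finally have tH: "along t1 t2 t3 H = 6 * ?E ^ 5" .
  show "squarefree (cnst c * (?E ^ 6 - H ^ 3)) \<Longrightarrow> free_with_exponents (cnst c * (?E ^ 6 - H ^ 3)) 7 10"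
    by (rule free_pencil_sextics[OF hE hH refl c _ _ _ _ tE tH]) (use t in simp_all)
  \<comment> \<open>Euler multiplies E by 3 and H by 6, so this combination gives 9 E H^2 - 9 E H^2
    = 0 on E and 18 (E^6 - H^3) on H.\<close>
  define u1 u2 u3 where u: "u1 = 3 * ?E * t1 - 3 * H\<^sup>2 * varX" "u2 = 3 * ?E * t2 - 3 * H\<^sup>2 * varY"
    "u3 = 3 * ?E * t3 - 3 * H\<^sup>2 * varZ"
  have hu: "homogeneous 13 u1" "homogeneous 13 u2" "homogeneous 13 u3"
    unfolding u
    by (intro homogeneous_diff[of _ "_ * t1"] homogeneous_diff[of _ "_ * t2"] homogeneous_diff[of _ "_ * t3"];
        rule homogeneous_cong, (rule homogeneous_mult homogeneous_power homogeneous_numeral hE hH homogeneous_var t)+, simp)+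
  have al: "along u1 u2 u3 g = 3 * ?E * along t1 t2 t3 g - 3 * H\<^sup>2 * (varX * dX g + varY * dY g + varZ * dZ g)" for g
    by (simp add: u along_def algebra_simps)
  have uE: "along u1 u2 u3 ?E = 0"
    unfolding al tE using euler_homogeneous[of 3 ?E] hE by simp
  have uH: "along u1 u2 u3 H = cnst 18 * (cnst 1 * ?E ^ 6 - H ^ 3)"
    unfolding al tH using euler_homogeneous[of 6 H] hH
    by (simp add: eval_nat_numeral algebra_simps)
  show "squarefree (cnst c * (?E * (?E ^ 6 - H ^ 3))) \<Longrightarrow>
      free_with_exponents (cnst c * (?E * (?E ^ 6 - H ^ 3))) 7 13"
    by (rule free_pencil_cubic_sextics[OF hE hH _ c _ hu uE uH]) simp_all
qed

lemma free_sextics_2: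
  fixes k c :: complex
  defines "B \<equiv> cnst k * symB"
  defines "H \<equiv> symA\<^sup>2 - 24 * symA * B - 72 * B\<^sup>2 - 36 * symC"
  assumes k: "k ^ 3 = 1" and c: "c \<noteq> 0"
    and sf: "squarefree (cnst c * ((symA - 3 * B) * ((symA - 3 * B) ^ 6 - H ^ 3)))"
  shows "free_with_exponents (cnst c * ((symA - 3 * B) * ((symA - 3 * B) ^ 6 - H ^ 3))) 7 13"
proof -
  let ?E = "symA - 3 * B"
  let ?p = "159 * symA ^ 3 * B - 6 * symA ^ 4 - 405 * symA\<^sup>2 * B\<^sup>2 + 204 * symA\<^sup>2 * symC
      - 2619 * symA * B ^ 3 - 1728 * symA * B * symC - 810 * B ^ 4 - 2160 * B\<^sup>2 * symC - 864 * symC\<^sup>2"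
    and ?q = "6 * symA ^ 3 - 171 * symA\<^sup>2 * B + 675 * symA * B\<^sup>2 - 180 * symA * symC + 2997 * B ^ 3
      + 1512 * B * symC"
    and ?r = "12 * symA ^ 3 - 306 * symA\<^sup>2 * B - 1350 * symA * B\<^sup>2 - 504 * symA * symC - 810 * B ^ 3
      - 432 * B * symC"
  have hB: "homogeneous 3 B" unfolding B_def by (rule homogeneous_sym)
  have hom: "homogeneous (int 9 + 3) ?p" "homogeneous (int 9) ?q" "homogeneous (int 9) ?r"
    by (intro homogeneous_add homogeneous_diff; rule homogeneous_cong,
        (rule homogeneous_mult homogeneous_power homogeneous_numeral hB homogeneous_sym)+, simp)+
  obtain t1 t2 t3 where t: "homogeneous (int 9 + 4) t1" "homogeneous (int 9 + 4) t2" "homogeneous (int 9 + 4) t3"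
    and A: "along t1 t2 t3 symA = 3 * ?p * symA + 3 * ?q * (symA\<^sup>2 - 2 * symC) + 9 * ?r * B\<^sup>2"
    and B: "along t1 t2 t3 B = 3 * ?p * B + ?q * symA * B + ?r * symC"
    and C: "along t1 t2 t3 symC = 6 * ?p * symC + 3 * ?q * (symA * symC - 3 * B ^ 3) + 6 * ?r * symA * B\<^sup>2"
    unfolding B_def by (rule invariant_derivation[OF k hom[unfolded B_def]])
  have hE: "homogeneous 3 ?E"
    by (intro homogeneous_diff; rule homogeneous_cong,
        (rule homogeneous_mult homogeneous_numeral hB homogeneous_sym)+, simp)
  have hH: "homogeneous 6 H" unfolding H_def
    by (intro homogeneous_add homogeneous_diff; rule homogeneous_cong,
        (rule homogeneous_mult homogeneous_power homogeneous_numeral hB homogeneous_sym)+, simp)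
  have "along t1 t2 t3 ?E = along t1 t2 t3 symA - 3 * along t1 t2 t3 B"
    by (simp add: along_simps)
  also have "\<dots> = 0"
    unfolding A B by (rule sextic_derivation_2(1))
  finally have tE: "along t1 t2 t3 ?E = 0" .
  have "along t1 t2 t3 H = 2 * symA * along t1 t2 t3 symA
      - 24 * (symA * along t1 t2 t3 B + along t1 t2 t3 symA * B)
      - 144 * B * along t1 t2 t3 B - 36 * along t1 t2 t3 symC"
    by (simp add: H_def along_simps algebra_simps)
  also have "\<dots> = 4 * (?E ^ 6 - H ^ 3)"
    unfolding A B C H_def by (rule sextic_derivation_2(2))
  finally have tH: "along t1 t2 t3 H = cnst 4 * (cnst 1 * ?E ^ 6 - H ^ 3)" by simp
  show ?thesis
    by (rule free_pencil_cubic_sextics[OF hE hH _ c sf _ _ _ tE tH]) (use t in simp_all)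
qed

section \<open>Products of conics\<close>

text \<open>As rewrite rules these reduce any polynomial in W to degree at most 1; the second rule
  catches the right-nested products that \<open>algebra_simps\<close> leaves.\<close>

lemma cube_root_reduce:
  fixes W :: "'a::comm_ring_1"
  assumes "W\<^sup>2 + W + 1 = 0"
  shows "W * W = - 1 - W" "W * (W * x) = - x - W * x"
proof -
  show W: "W * W = - 1 - W"
    using assms by (simp add: power2_eq_square eq_diff_eq eq_neg_iff_add_eq_0)
  have "W * (W * x) = (W * W) * x" by (simp only: mult.assoc)
  then show "W * (W * x) = - x - W * x" by (simp add: W left_diff_distrib)
qed

lemma cube_root_power:
  fixes W :: "'a::comm_ring_1"
  assumes "W\<^sup>2 + W + 1 = 0"
  shows "W ^ 3 = 1"
  by (simp add: power3_eq_cube cube_root_reduce[OF assms] algebra_simps)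

text \<open>This is the product of a + s b + s^2 c over the cube roots of unity s;
  \<open>W ^ 4\<close> stays unreduced because the factor for s = W^2 arrives in that form.\<close>

lemma cube_root_product:
  fixes a b c W :: "'a::comm_ring_1"
  assumes "W\<^sup>2 + W + 1 = 0"
  shows "(a + b + c) * ((a + W * b + W\<^sup>2 * c) * (a + W\<^sup>2 * b + W ^ 4 * c)) = a ^ 3 + b ^ 3 + c ^ 3 - 3 * a * b * c"
  by (simp add: eval_nat_numeral algebra_simps cube_root_reduce[OF assms])

text \<open>The conic \<open>f\<^sub>1\<^sub>2(\<kappa>\<lambda>)\<close> after the substitution \<open>y \<mapsto> s y\<close>, \<open>z \<mapsto> \<kappa> s\<^sup>2 z\<close>. When \<open>\<kappa>\<close> and \<open>s\<close> run over the
  cube roots of unity, these are the nine forms other than \<open>f\<^sub>3\<close>, \<open>f\<^sub>7\<close>, \<open>f\<^sub>1\<^sub>1\<close>.\<close>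

definition hesse_conic :: "complex \<Rightarrow> complex \<Rightarrow> complex \<Rightarrow> poly3" where
  "hesse_conic \<kappa> s l = conic (s * (\<kappa> * l + 1)) (\<kappa> * s\<^sup>2 * (\<kappa> * l + 1)) (\<kappa> * (\<kappa> * l + 1)) (s\<^sup>2) (\<kappa>\<^sup>2 * s)"

text \<open>The product of one orbit of three conics, for N = \<kappa>\<lambda> and B = \<kappa>
  xyz. The coefficient of \<open>symC\<close> is (N - 1)(N + 2)^2; where it vanishes, at N = 1 and N
  = -2, the rest is the square of \<open>symA - 3 * B\<close>: the double lines.\<close>

definition sextic :: "poly3 \<Rightarrow> poly3 \<Rightarrow> poly3" where
  "sextic N B = symA\<^sup>2 - (3 * N\<^sup>2 + 3 * N) * symA * B + (N ^ 3 + 3 * N\<^sup>2 - 4) * symC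
     + (3 + 9 * N - 3 * N ^ 3) * B\<^sup>2"

lemma sextic_expansion:
  fixes x y z N :: "'a::comm_ring_1"
  defines "A \<equiv> x ^ 3 + y ^ 3 + z ^ 3" and "B \<equiv> x * y * z"
    and "C \<equiv> (x * y) ^ 3 + (y * z) ^ 3 + (z * x) ^ 3"
  defines "a \<equiv> x\<^sup>2 + (N + 1) * (y * z)" and "b \<equiv> (N + 1) * (x * y) + z\<^sup>2" and "c \<equiv> (N + 1) * (x * z) + y\<^sup>2"
  shows "a ^ 3 + b ^ 3 + c ^ 3 - 3 * a * b * c =
    A\<^sup>2 - (3 * N\<^sup>2 + 3 * N) * A * B + (N ^ 3 + 3 * N\<^sup>2 - 4) * C + (3 + 9 * N - 3 * N ^ 3) * B\<^sup>2"
  unfolding assms by (simp add: eval_nat_numeral algebra_simps)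

lemma coordinate_conics_expansion:
  fixes x y z L :: "'a::comm_ring_1"
  shows "(x * y - L * z\<^sup>2) * (x * z - L * y\<^sup>2) * (L * x\<^sup>2 - y * z) =
    L * (x ^ 3 + y ^ 3 + z ^ 3) * (x * y * z) - L\<^sup>2 * ((x * y) ^ 3 + (y * z) ^ 3 + (z * x) ^ 3)
      + (L ^ 3 - 1) * (x * y * z)\<^sup>2"
  by (simp add: eval_nat_numeral algebra_simps)

text \<open>Put e = A - 3 B and g = C - A B, where g is the orbit of coordinate conics up to a
  constant. With H = e^2 - 9 g the form e^6 - H^3 has the factor e^2 - H = 9 g and the cofactor 3
  (e^4 - 9 e^2 g + 27 g^2), which explains the 27; the quartic in e splits into the other two
  orbits.\<close>

lemma pencil_product_1:
  fixes A B C W :: "'a::comm_ring_1"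
  assumes W: "W\<^sup>2 + W + 1 = 0"
  defines "P \<equiv> \<lambda>N B. A\<^sup>2 - (3 * N\<^sup>2 + 3 * N) * A * B + (N ^ 3 + 3 * N\<^sup>2 - 4) * C
     + (3 + 9 * N - 3 * N ^ 3) * B\<^sup>2"
  shows "27 * (P W (W * B) * P (W\<^sup>2) (W\<^sup>2 * B) * (C - A * B)) =
    (A - 3 * B) ^ 6 - (A\<^sup>2 + 3 * A * B + 9 * B\<^sup>2 - 9 * C) ^ 3"
proof -
  have P1: "P W (W * B) = (A - 3 * B)\<^sup>2 - 3 * (W + 2) * (C - A * B)"
    unfolding P_def by (simp add: eval_nat_numeral algebra_simps cube_root_reduce[OF W])
  have P2: "P (W\<^sup>2) (W\<^sup>2 * B) = (A - 3 * B)\<^sup>2 - 3 * (W\<^sup>2 + 2) * (C - A * B)"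
    unfolding P_def by (simp add: eval_nat_numeral algebra_simps cube_root_reduce[OF W])
  have P12: "(e\<^sup>2 - 3 * (W + 2) * g) * (e\<^sup>2 - 3 * (W\<^sup>2 + 2) * g) = e ^ 4 - 9 * e\<^sup>2 * g + 27 * g\<^sup>2" for e g
    by (simp add: eval_nat_numeral algebra_simps cube_root_reduce[OF W])
  have "27 * (P W (W * B) * P (W\<^sup>2) (W\<^sup>2 * B) * (C - A * B)) =
      27 * ((A - 3 * B) ^ 4 - 9 * (A - 3 * B)\<^sup>2 * (C - A * B) + 27 * (C - A * B)\<^sup>2) * (C - A * B)"
    unfolding P1 P2 P12 by (simp only: mult.assoc)
  also have "\<dots> = (A - 3 * B) ^ 6 - (A\<^sup>2 + 3 * A * B + 9 * B\<^sup>2 - 9 * C) ^ 3"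
    by (simp add: eval_nat_numeral algebra_simps)
  finally show ?thesis .
qed

text \<open>The same splitting for g = 4 C + 2 A B + 9 B^2, again with H = e^2 - 9 g.\<close>

lemma pencil_product_2:
  fixes A B C W :: "'a::comm_ring_1"
  assumes W: "W\<^sup>2 + W + 1 = 0"
  defines "P \<equiv> \<lambda>N B. A\<^sup>2 - (3 * N\<^sup>2 + 3 * N) * A * B + (N ^ 3 + 3 * N\<^sup>2 - 4) * C
     + (3 + 9 * N - 3 * N ^ 3) * B\<^sup>2"
  shows "27 * (P (- 2 * W) (W * B) * P (- 2 * W\<^sup>2) (W\<^sup>2 * B) * (4 * C + 2 * A * B + 9 * B\<^sup>2)) =
    (A - 3 * B) ^ 6 - (A\<^sup>2 - 24 * A * B - 72 * B\<^sup>2 - 36 * C) ^ 3"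
proof -
  have P1: "P (- 2 * W) (W * B) = (A - 3 * B)\<^sup>2 + 3 * (W\<^sup>2 - 1) * (4 * C + 2 * A * B + 9 * B\<^sup>2)"
    unfolding P_def by (simp add: eval_nat_numeral algebra_simps cube_root_reduce[OF W])
  have P2: "P (- 2 * W\<^sup>2) (W\<^sup>2 * B) = (A - 3 * B)\<^sup>2 + 3 * (W - 1) * (4 * C + 2 * A * B + 9 * B\<^sup>2)"
    unfolding P_def by (simp add: eval_nat_numeral algebra_simps cube_root_reduce[OF W])
  have P12: "(e\<^sup>2 + 3 * (W\<^sup>2 - 1) * g) * (e\<^sup>2 + 3 * (W - 1) * g) = e ^ 4 - 9 * e\<^sup>2 * g + 27 * g\<^sup>2" for e g
    by (simp add: eval_nat_numeral algebra_simps cube_root_reduce[OF W])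
  have "27 * (P (- 2 * W) (W * B) * P (- 2 * W\<^sup>2) (W\<^sup>2 * B) * (4 * C + 2 * A * B + 9 * B\<^sup>2)) =
      27 * ((A - 3 * B) ^ 4 - 9 * (A - 3 * B)\<^sup>2 * (4 * C + 2 * A * B + 9 * B\<^sup>2)
        + 27 * (4 * C + 2 * A * B + 9 * B\<^sup>2)\<^sup>2) * (4 * C + 2 * A * B + 9 * B\<^sup>2)"
    unfolding P1 P2 P12 by (simp only: mult.assoc)
  also have "\<dots> = (A - 3 * B) ^ 6 - (A\<^sup>2 - 24 * A * B - 72 * B\<^sup>2 - 36 * C) ^ 3"
    by (simp add: eval_nat_numeral algebra_simps)
  finally show ?thesis .
qed

lemma cube_reduce:
  fixes s :: "'a::comm_ring_1"
  assumes "s ^ 3 = 1"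
  shows "s * (s * s) = 1" "s * (s * (s * x)) = x"
  using assms by (simp_all add: power3_eq_cube flip: mult.assoc)

lemma hesse_conic_coefficients:
  fixes W l :: "'a::comm_ring_1"
  assumes "W ^ 3 = 1"
  defines "h \<equiv> \<lambda>\<kappa> s. (s * (\<kappa> * l + 1), \<kappa> * s\<^sup>2 * (\<kappa> * l + 1), \<kappa> * (\<kappa> * l + 1), s\<^sup>2, \<kappa>\<^sup>2 * s)"
  shows "h 1 W = (W * (l + 1), W\<^sup>2 * (l + 1), l + 1, W\<^sup>2, W)"
    "h 1 (W\<^sup>2) = (W\<^sup>2 * (l + 1), W * (l + 1), l + 1, W, W\<^sup>2)"
    "h 1 1 = (l + 1, l + 1, l + 1, 1, 1)"
    "h W 1 = (W * l + 1, W * (W * l + 1), W * (W * l + 1), 1, W\<^sup>2)"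
    "h W W = (W\<^sup>2 * l + W, W\<^sup>2 * (W\<^sup>2 * l + W), W\<^sup>2 * l + W, W\<^sup>2, 1)"
    "h W (W\<^sup>2) = (l + W\<^sup>2, l + W\<^sup>2, W\<^sup>2 * (l + W\<^sup>2), W, W)"
    "h (W\<^sup>2) 1 = (W\<^sup>2 * l + 1, W\<^sup>2 * (W\<^sup>2 * l + 1), W\<^sup>2 * (W\<^sup>2 * l + 1), 1, W)"
    "h (W\<^sup>2) W = (l + W, l + W, W * (l + W), W\<^sup>2, W\<^sup>2)"
    "h (W\<^sup>2) (W\<^sup>2) = (W * l + W\<^sup>2, W * (W * l + W\<^sup>2), W * l + W\<^sup>2, W, 1)"
  unfolding h_def by (simp_all add: power2_eq_square distrib_left mult_ac cube_reduce[OF assms(1)])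

text \<open>For m = \<kappa>\<lambda> + 1 and nonzero \<kappa> the right side vanishes only if
  \<kappa>\<lambda> is 1 or -2, the parameters at which the orbit becomes double lines.\<close>

lemma discriminant_identity:
  fixes s k m :: "'a::comm_ring_1"
  assumes "s ^ 3 = 1"
  shows "4 * s\<^sup>2 * (k\<^sup>2 * s) + (s * m) * (k * s\<^sup>2 * m) * (k * m) - (k * m)\<^sup>2 - (s * m)\<^sup>2 * (k\<^sup>2 * s)
    - (k * s\<^sup>2 * m)\<^sup>2 * s\<^sup>2 = k\<^sup>2 * (m - 2)\<^sup>2 * (m + 1)"
  by (simp add: power2_eq_square algebra_simps cube_reduce[OF assms])

text \<open>In these arrangements no multiplicity exceeds 2, so trapping h between the product of
  the primes and its square determines its prime divisors, without any account of units or exact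
  exponents.\<close>

lemma set_prime_factorization_eqI:
  fixes h :: poly3
  assumes F: "finite F" "\<And>p. p \<in> F \<Longrightarrow> prime p" and dvd: "\<Prod>F dvd h" "h dvd (\<Prod>F)\<^sup>2"
  shows "set_mset (prime_factorization h) = F"
proof -
  have "0 \<notin> F" using F(2) not_prime_0 by blast
  then have "\<Prod>F \<noteq> 0" using F(1) by simp
  then have h: "h \<noteq> 0" using dvd(2) by auto
  have "p \<in> F" if p: "prime p" "p dvd h" for p
  proof -
    have "p dvd (\<Prod>F)\<^sup>2" using p(2) dvd(2) by (rule dvd_trans)
    then have "p dvd \<Prod>F" using p(1) by (simp add: prime_dvd_power_iff)
    then obtain q where "q \<in> F" "p dvd q"
      using prime_dvd_prod_iff[OF F(1) p(1), where f = "\<lambda>x. x"] by auto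
    then have "p = q" using primes_dvd_imp_eq[OF p(1)] F(2) by blast
    with \<open>q \<in> F\<close> show ?thesis by simp
  qed
  moreover have "p dvd h" if "p \<in> F" for p
    using dvd_prodI[OF F(1) that, of "\<lambda>x. x"] dvd(1) by (rule dvd_trans)
  ultimately show ?thesis
    unfolding prime_factors_dvd[OF h] using F(2) by blast
qed

lemma squarefree_prod_primes:
  fixes F :: "poly3 set"
  assumes "finite F" "\<And>p. p \<in> F \<Longrightarrow> prime p"
  shows "squarefree (\<Prod>F)"
proof (rule squarefree_prod_coprime)
  fix p q assume "p \<in> F" "q \<in> F" "p \<noteq> q"
  then show "coprime p q" using assms(2) by (intro primes_coprime)
next
  fix p assume "p \<in> F"
  then show "squarefree p" by (intro squarefree_prime assms(2))
qed

context
  fixes \<omega> :: complex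
  assumes \<omega>: "\<omega>\<^sup>2 + \<omega> + 1 = 0"
begin

lemma omega_cube: "\<omega> ^ 3 = 1"
  by (rule cube_root_power[OF \<omega>])

lemma omega_distinct: "\<omega> \<noteq> 0" "\<omega> \<noteq> 1" "\<omega>\<^sup>2 \<noteq> 1" "\<omega>\<^sup>2 \<noteq> \<omega>" "\<omega>\<^sup>2 \<noteq> 0"
proof -
  show "\<omega> \<noteq> 0" "\<omega> \<noteq> 1" using \<omega> by auto
  then show "\<omega>\<^sup>2 \<noteq> \<omega>" "\<omega>\<^sup>2 \<noteq> 0" by (auto simp: power2_eq_square)
  show "\<omega>\<^sup>2 \<noteq> 1"
  proof
    assume "\<omega>\<^sup>2 = 1"
    moreover from this have "\<omega> = - 2" using \<omega> by (simp add: eq_neg_iff_add_eq_0 add.commute)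
    ultimately show False by simp
  qed
qed

definition "cube_roots = {1, \<omega>, \<omega>\<^sup>2}"

lemma finite_cube_roots [simp]: "finite cube_roots"
  by (simp add: cube_roots_def)

lemma cube_rootsD: "s \<in> cube_roots \<Longrightarrow> s ^ 3 = 1"
proof -
  have "(\<omega>\<^sup>2) ^ 3 = (\<omega> ^ 3)\<^sup>2" by (simp flip: power_mult)
  then have "(\<omega>\<^sup>2) ^ 3 = 1" by (simp add: omega_cube)
  then show "s \<in> cube_roots \<Longrightarrow> s ^ 3 = 1" by (auto simp: cube_roots_def omega_cube)
qed

lemma prod_cube_roots: "(\<Prod>s\<in>cube_roots. g s) = g 1 * (g \<omega> * g (\<omega>\<^sup>2))" for g :: "complex \<Rightarrow> poly3"
  using omega_distinct by (simp add: cube_roots_def)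

lemma cnst_omega: "(cnst \<omega>)\<^sup>2 + cnst \<omega> + 1 = 0"
  using arg_cong[OF \<omega>, of cnst] by simp

text \<open>For fixed \<kappa> the conics are a + s b + s^2 c with a, b, c independent of s.
  Replacing z by \<kappa> z, with \<kappa>^3 = 1, fixes \<open>symA\<close> and \<open>symC\<close>
  and multiplies \<open>symB\<close> by \<kappa>.\<close>

lemma triple_product:
  assumes k: "\<kappa> ^ 3 = 1"
  shows "(\<Prod>s\<in>cube_roots. hesse_conic \<kappa> s l) = sextic (cnst (\<kappa> * l)) (cnst \<kappa> * symB)"
proof -
  let ?N = "cnst (\<kappa> * l)" and ?Z = "cnst \<kappa> * varZ" and ?W = "cnst \<omega>"
  let ?a = "varX\<^sup>2 + (?N + 1) * (varY * ?Z)" and ?b = "(?N + 1) * (varX * varY) + ?Z\<^sup>2"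
    and ?c = "(?N + 1) * (varX * ?Z) + varY\<^sup>2"
  have K: "cnst \<kappa> ^ 3 = 1" using k by (metis cnst_power cnst_simps(2))
  have h: "hesse_conic \<kappa> s l = ?a + cnst s * ?b + cnst (s\<^sup>2) * ?c" for s
    by (simp add: hesse_conic_def conic_def power_mult_distrib algebra_simps power2_eq_square)
  have "(\<Prod>s\<in>cube_roots. hesse_conic \<kappa> s l) =
      (?a + ?b + ?c) * ((?a + ?W * ?b + ?W\<^sup>2 * ?c) * (?a + ?W\<^sup>2 * ?b + ?W ^ 4 * ?c))"
    unfolding prod_cube_roots h by (simp flip: power_mult)
  also have "\<dots> = ?a ^ 3 + ?b ^ 3 + ?c ^ 3 - 3 * ?a * ?b * ?c"
    by (rule cube_root_product[OF cnst_omega])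
  also have "\<dots> = sextic ?N (cnst \<kappa> * symB)"
    unfolding sextic_expansion
    by (simp add: sextic_def symA_def symB_def symC_def power_mult_distrib K mult_ac)
  finally show ?thesis .
qed

lemma line_product:
  assumes k: "k ^ 3 = 1"
  shows "(\<Prod>s\<in>cube_roots. line s (k * s\<^sup>2)) = symA - 3 * (cnst k * symB)"
proof -
  let ?Z = "cnst k * varZ" and ?W = "cnst \<omega>"
  have K: "cnst k ^ 3 = 1" using k by (metis cnst_power cnst_simps(2))
  have h: "line s (k * s\<^sup>2) = varX + cnst s * varY + cnst (s\<^sup>2) * ?Z" for s
    by (simp add: line_def algebra_simps)
  have "(\<Prod>s\<in>cube_roots. line s (k * s\<^sup>2)) =
      (varX + varY + ?Z) * ((varX + ?W * varY + ?W\<^sup>2 * ?Z) * (varX + ?W\<^sup>2 * varY + ?W ^ 4 * ?Z))"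
    unfolding prod_cube_roots h by (simp flip: power_mult)
  also have "\<dots> = varX ^ 3 + varY ^ 3 + ?Z ^ 3 - 3 * varX * varY * ?Z"
    by (rule cube_root_product[OF cnst_omega])
  finally show ?thesis
    by (simp add: symA_def symB_def power_mult_distrib K mult_ac)
qed

lemma hesse_poly_eq:
  "hesse_poly \<omega> l = (\<Prod>\<kappa>\<in>cube_roots. \<Prod>s\<in>cube_roots. hesse_conic \<kappa> s l) *
    ((varX * varY - cnst l * varZ\<^sup>2) * (varX * varZ - cnst l * varY\<^sup>2) * (cnst l * varX\<^sup>2 - varY * varZ))"
proof -
  have conics: "hesse_conics \<omega> l =
    [conic (\<omega> * (l + 1)) (\<omega>\<^sup>2 * (l + 1)) (l + 1) (\<omega>\<^sup>2) \<omega>,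
     conic (\<omega>\<^sup>2 * (l + 1)) (\<omega> * (l + 1)) (l + 1) \<omega> (\<omega>\<^sup>2),
     varX * varY - cnst l * varZ\<^sup>2,
     conic (\<omega> * l + 1) (\<omega> * (\<omega> * l + 1)) (\<omega> * (\<omega> * l + 1)) 1 (\<omega>\<^sup>2),
     conic (\<omega>\<^sup>2 * l + 1) (\<omega>\<^sup>2 * (\<omega>\<^sup>2 * l + 1)) (\<omega>\<^sup>2 * (\<omega>\<^sup>2 * l + 1)) 1 \<omega>,
     conic (\<omega> * l + \<omega>\<^sup>2) (\<omega> * (\<omega> * l + \<omega>\<^sup>2)) (\<omega> * l + \<omega>\<^sup>2) \<omega> 1,
     varX * varZ - cnst l * varY\<^sup>2,
     conic (\<omega>\<^sup>2 * l + \<omega>) (\<omega>\<^sup>2 * (\<omega>\<^sup>2 * l + \<omega>)) (\<omega>\<^sup>2 * l + \<omega>) (\<omega>\<^sup>2) 1,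
     conic (l + \<omega>\<^sup>2) (l + \<omega>\<^sup>2) (\<omega>\<^sup>2 * (l + \<omega>\<^sup>2)) \<omega> \<omega>,
     conic (l + \<omega>) (l + \<omega>) (\<omega> * (l + \<omega>)) (\<omega>\<^sup>2) (\<omega>\<^sup>2),
     cnst l * varX\<^sup>2 - varY * varZ,
     conic (l + 1) (l + 1) (l + 1) 1 1]"
    by (simp add: hesse_conics_def Let_def conic_def algebra_simps)
  \<comment> \<open>Packing the five coefficients into one tuple lets each coefficient identity
    rewrite them all at once.\<close>
  have coeffs: "hesse_conic \<kappa> s l = (case (s * (\<kappa> * l + 1), \<kappa> * s\<^sup>2 * (\<kappa> * l + 1), \<kappa> * (\<kappa> * l + 1),
      s\<^sup>2, \<kappa>\<^sup>2 * s) of (a, b, c, d, e) \<Rightarrow> conic a b c d e)" for \<kappa> s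
    by (simp only: hesse_conic_def prod.case)
  have e:
    "conic (\<omega> * (l + 1)) (\<omega>\<^sup>2 * (l + 1)) (l + 1) (\<omega>\<^sup>2) \<omega> = hesse_conic 1 \<omega> l"
    "conic (\<omega>\<^sup>2 * (l + 1)) (\<omega> * (l + 1)) (l + 1) \<omega> (\<omega>\<^sup>2) = hesse_conic 1 (\<omega>\<^sup>2) l"
    "conic (l + 1) (l + 1) (l + 1) 1 1 = hesse_conic 1 1 l"
    "conic (\<omega> * l + 1) (\<omega> * (\<omega> * l + 1)) (\<omega> * (\<omega> * l + 1)) 1 (\<omega>\<^sup>2) = hesse_conic \<omega> 1 l"
    "conic (\<omega>\<^sup>2 * l + \<omega>) (\<omega>\<^sup>2 * (\<omega>\<^sup>2 * l + \<omega>)) (\<omega>\<^sup>2 * l + \<omega>) (\<omega>\<^sup>2) 1 = hesse_conic \<omega> \<omega> l"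
    "conic (l + \<omega>\<^sup>2) (l + \<omega>\<^sup>2) (\<omega>\<^sup>2 * (l + \<omega>\<^sup>2)) \<omega> \<omega> = hesse_conic \<omega> (\<omega>\<^sup>2) l"
    "conic (\<omega>\<^sup>2 * l + 1) (\<omega>\<^sup>2 * (\<omega>\<^sup>2 * l + 1)) (\<omega>\<^sup>2 * (\<omega>\<^sup>2 * l + 1)) 1 \<omega> = hesse_conic (\<omega>\<^sup>2) 1 l"
    "conic (l + \<omega>) (l + \<omega>) (\<omega> * (l + \<omega>)) (\<omega>\<^sup>2) (\<omega>\<^sup>2) = hesse_conic (\<omega>\<^sup>2) \<omega> l"
    "conic (\<omega> * l + \<omega>\<^sup>2) (\<omega> * (\<omega> * l + \<omega>\<^sup>2)) (\<omega> * l + \<omega>\<^sup>2) \<omega> 1 = hesse_conic (\<omega>\<^sup>2) (\<omega>\<^sup>2) l"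
    unfolding coeffs hesse_conic_coefficients[OF omega_cube] prod.case by (rule refl)+
  show ?thesis
    unfolding hesse_poly_def conics e prod_cube_roots by (simp add: mult_ac)
qed

lemma hesse_conic_discriminant:
  assumes "\<kappa> \<in> cube_roots" "s \<in> cube_roots" "\<kappa> * l \<noteq> 1" "\<kappa> * l \<noteq> - 2"
  defines "m \<equiv> \<kappa> * l + 1"
  shows "4 * s\<^sup>2 * (\<kappa>\<^sup>2 * s) + (s * m) * (\<kappa> * s\<^sup>2 * m) * (\<kappa> * m) - (\<kappa> * m)\<^sup>2 - (s * m)\<^sup>2 * (\<kappa>\<^sup>2 * s)
    - (\<kappa> * s\<^sup>2 * m)\<^sup>2 * s\<^sup>2 \<noteq> 0"
proof -
  have s: "s ^ 3 = 1" using assms(2) by (rule cube_rootsD)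
  have "\<kappa> \<noteq> 0" using cube_rootsD[OF assms(1)] by auto
  have "4 * s\<^sup>2 * (\<kappa>\<^sup>2 * s) + (s * m) * (\<kappa> * s\<^sup>2 * m) * (\<kappa> * m) - (\<kappa> * m)\<^sup>2 - (s * m)\<^sup>2 * (\<kappa>\<^sup>2 * s)
    - (\<kappa> * s\<^sup>2 * m)\<^sup>2 * s\<^sup>2 = \<kappa>\<^sup>2 * (m - 2)\<^sup>2 * (m + 1)"
    by (rule discriminant_identity[OF s])
  also have "\<dots> \<noteq> 0"
  proof -
    have "m - 2 \<noteq> 0" "m + 1 \<noteq> 0"
      using assms(3,4) by (simp_all add: m_def eq_neg_iff_add_eq_0 add.commute)
    with \<open>\<kappa> \<noteq> 0\<close> show ?thesis by simp
  qed
  finally show ?thesis .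
qed

lemma hesse_conic_prime_smooth:
  assumes "\<kappa> \<in> cube_roots" "s \<in> cube_roots" "\<kappa> * l \<noteq> 1" "\<kappa> * l \<noteq> - 2"
  shows "prime (hesse_conic \<kappa> s l)" "is_smooth_conic (hesse_conic \<kappa> s l)"
  unfolding hesse_conic_def using hesse_conic_discriminant[OF assms]
  by (auto intro!: prime_conic smooth_conic)

lemma inj_on_hesse_conic: "inj_on (\<lambda>(\<kappa>, s). hesse_conic \<kappa> s l) (cube_roots \<times> cube_roots)"
proof (rule inj_onI, clarify)
  fix \<kappa> s \<kappa>' s' assume *: "\<kappa> \<in> cube_roots" "s \<in> cube_roots" "\<kappa>' \<in> cube_roots" "s' \<in> cube_roots"
    and "hesse_conic \<kappa> s l = hesse_conic \<kappa>' s' l"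
  then have e: "s\<^sup>2 = s'\<^sup>2" "\<kappa>\<^sup>2 * s = \<kappa>'\<^sup>2 * s'" by (simp_all add: hesse_conic_def)
  \<comment> \<open>A cube root of unity satisfies u = u^4, so it is recovered from its
    square.\<close>
  have inj: "u = u'" if "u ^ 3 = 1" "u' ^ 3 = 1" "u\<^sup>2 = u'\<^sup>2" for u u' :: complex
  proof -
    have "u = u ^ 3 * u" "u' = u' ^ 3 * u'" using that by simp_all
    then have "u = (u\<^sup>2)\<^sup>2" "u' = (u'\<^sup>2)\<^sup>2" by (simp_all add: eval_nat_numeral mult_ac)
    with that(3) show ?thesis by simp
  qed
  have "s = s'" using inj e(1) * by (simp add: cube_rootsD)
  moreover have "s \<noteq> 0" using cube_rootsD[OF *(2)] by auto
  ultimately have "\<kappa>\<^sup>2 = \<kappa>'\<^sup>2" using e(2) by simp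
  with inj * have "\<kappa> = \<kappa>'" by (simp add: cube_rootsD)
  with \<open>s = s'\<close> show "\<kappa> = \<kappa>' \<and> s = s'" by simp
qed

lemma prod_hesse_conics:
  assumes "K \<subseteq> cube_roots"
  shows "\<Prod>((\<lambda>(\<kappa>, s). hesse_conic \<kappa> s l) ` (K \<times> cube_roots))
    = (\<Prod>\<kappa>\<in>K. sextic (cnst (\<kappa> * l)) (cnst \<kappa> * symB))"
proof -
  have "inj_on (\<lambda>(\<kappa>, s). hesse_conic \<kappa> s l) (K \<times> cube_roots)"
    by (rule inj_on_subset[OF inj_on_hesse_conic]) (use assms in auto)
  then have "\<Prod>((\<lambda>(\<kappa>, s). hesse_conic \<kappa> s l) ` (K \<times> cube_roots))
      = (\<Prod>\<kappa>\<in>K. \<Prod>s\<in>cube_roots. hesse_conic \<kappa> s l)"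
    by (subst prod.reindex) (simp_all add: prod.cartesian_product case_prod_unfold)
  also have "\<dots> = (\<Prod>\<kappa>\<in>K. sextic (cnst (\<kappa> * l)) (cnst \<kappa> * symB))"
    using assms by (intro prod.cong refl triple_product cube_rootsD) auto
  finally show ?thesis .
qed

end

section \<open>The arrangements\<close>

lemma sextic_product_0:
  fixes G B W :: "'a::comm_ring_1"
  assumes "W\<^sup>2 + W + 1 = 0"
  shows "(3 * B\<^sup>2 - G) * ((3 * (W * B)\<^sup>2 - G) * (3 * (W\<^sup>2 * B)\<^sup>2 - G)) = 27 * B ^ 6 - G ^ 3"
  by (simp add: eval_nat_numeral algebra_simps cube_root_reduce[OF assms])

lemma cnst_inverse_mult:
  assumes "l \<noteq> 0"
  shows "cnst l * (cnst (1 / l) * q) = q" "cnst (1 / l) * (cnst l * q) = q"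
proof -
  have "cnst l * cnst (1 / l) = 1" using assms by (simp flip: cnst_simps(2,4))
  then show "cnst l * (cnst (1 / l) * q) = q" by (simp flip: mult.assoc)
  then show "cnst (1 / l) * (cnst l * q) = q" by (simp only: mult.left_commute)
qed

text \<open>The third member is \<open>cnst l * varX^2 - varY * varZ\<close> divided by
  \<open>l\<close>, the normalized form that a prime factorization contains.\<close>

definition coordinate_conics :: "complex \<Rightarrow> poly3 set" where
  "coordinate_conics l =
    {varX * varY - cnst l * varZ\<^sup>2, varX * varZ - cnst l * varY\<^sup>2, conic 0 0 (- 1 / l) 0 0}"

lemma coordinate_conics_prime_smooth:
  assumes "l \<noteq> 0" "q \<in> coordinate_conics l"
  shows "prime q" "is_smooth_conic q"
proof -
  have "4 * 0 * 0 + 0 * 0 * (- 1 / l) - (- 1 / l)\<^sup>2 - 0\<^sup>2 * 0 - 0\<^sup>2 * 0 \<noteq> 0"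
    using assms(1) by simp
  note * = prime_conic[OF this] smooth_conic[OF this]
  show "prime q" "is_smooth_conic q"
    using assms * prime_xy_conic prime_xz_conic smooth_xy_conic smooth_xz_conic
    unfolding coordinate_conics_def by blast+
qed

lemma coordinate_conics_distinct:
  assumes "l \<noteq> 0"
  shows "varX * varY - cnst l * varZ\<^sup>2 \<noteq> varX * varZ - cnst l * varY\<^sup>2"
    "varX * varY - cnst l * varZ\<^sup>2 \<noteq> conic a b c d e" "varX * varZ - cnst l * varY\<^sup>2 \<noteq> conic a b c d e"
proof -
  have ne: "p \<noteq> q" if "eval3 p u v w \<noteq> eval3 q u v w" for p q u v w
    using that by auto
  show "varX * varY - cnst l * varZ\<^sup>2 \<noteq> varX * varZ - cnst l * varY\<^sup>2"
    by (rule ne[of _ 0 1 0]) (use assms in \<open>simp add: power2_eq_square\<close>)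
  show "varX * varY - cnst l * varZ\<^sup>2 \<noteq> conic a b c d e" "varX * varZ - cnst l * varY\<^sup>2 \<noteq> conic a b c d e"
    by (rule ne[of _ 1 0 0]; simp add: conic_def power2_eq_square)+
qed

lemma prod_coordinate_conics:
  assumes "l \<noteq> 0"
  shows "cnst l * \<Prod>(coordinate_conics l) =
    (varX * varY - cnst l * varZ\<^sup>2) * (varX * varZ - cnst l * varY\<^sup>2) * (cnst l * varX\<^sup>2 - varY * varZ)"
proof -
  have c: "cnst l * conic 0 0 (- 1 / l) 0 0 = cnst l * varX\<^sup>2 - varY * varZ"
    using cnst_inverse_mult(1)[OF assms] by (simp add: conic_def right_diff_distrib mult.assoc)
  have "\<Prod>(coordinate_conics l) = (varX * varY - cnst l * varZ\<^sup>2) * ((varX * varZ - cnst l * varY\<^sup>2) * conic 0 0 (- 1 / l) 0 0)"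
    unfolding coordinate_conics_def using coordinate_conics_distinct[OF assms] by simp
  then show ?thesis unfolding c[symmetric] by (simp only: mult_ac)
qed

context
  fixes \<omega> :: complex
  assumes \<omega>: "\<omega>\<^sup>2 + \<omega> + 1 = 0"
begin

abbreviation "\<Omega> \<equiv> cube_roots \<omega>"

definition "conics K l = (\<lambda>(\<kappa>, s). hesse_conic \<kappa> s l) ` (K \<times> \<Omega>)"
definition "lines k = (\<lambda>s. line s (k * s\<^sup>2)) ` \<Omega>"

lemmas \<Omega>D = cube_rootsD[OF \<omega>]

lemma finite_conics: "K \<subseteq> \<Omega> \<Longrightarrow> finite (conics K l)"
  unfolding conics_def
  by (intro finite_imageI finite_cartesian_product finite_cube_roots[OF \<omega>])
    (rule finite_subset[OF _ finite_cube_roots[OF \<omega>]])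

lemma conics_prime_smooth:
  assumes "K \<subseteq> \<Omega>" "\<And>\<kappa>. \<kappa> \<in> K \<Longrightarrow> \<kappa> * l \<noteq> 1 \<and> \<kappa> * l \<noteq> - 2" "q \<in> conics K l"
  shows "prime q" "is_smooth_conic q"
proof -
  obtain \<kappa> s where q: "\<kappa> \<in> K" "s \<in> \<Omega>" "q = hesse_conic \<kappa> s l"
    using assms(3) unfolding conics_def by auto
  then have "\<kappa> \<in> \<Omega>" "\<kappa> * l \<noteq> 1" "\<kappa> * l \<noteq> - 2" using assms(1,2) by auto
  then show "prime q" "is_smooth_conic q"
    using hesse_conic_prime_smooth[OF \<omega> _ q(2)] unfolding q(3) by simp_all
qed

lemma conics_disjoint_coordinate_conics:
  assumes "K \<subseteq> \<Omega>" "l \<noteq> 0"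
  shows "conics K l \<inter> coordinate_conics l = {}"
proof -
  have "hesse_conic \<kappa> s l \<notin> coordinate_conics l" if "s \<in> \<Omega>" for \<kappa> s
  proof -
    have "s \<noteq> 0" using \<Omega>D[OF that] by auto
    then show ?thesis
      using coordinate_conics_distinct(2,3)[OF assms(2), THEN not_sym]
      unfolding coordinate_conics_def hesse_conic_def by simp
  qed
  then show ?thesis unfolding conics_def by auto
qed

lemma prod_lines:
  assumes "k \<in> \<Omega>"
  shows "\<Prod>(lines k) = symA - 3 * (cnst k * symB)"
proof -
  have "inj_on (\<lambda>s. line s (k * s\<^sup>2)) \<Omega>"
  proof (rule inj_onI)
    fix s s' assume "line s (k * s\<^sup>2) = line s' (k * s'\<^sup>2)"
    then have "eval3 (line s (k * s\<^sup>2)) 0 1 0 = eval3 (line s' (k * s'\<^sup>2)) 0 1 0" by simp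
    then show "s = s'" by (simp add: line_def)
  qed
  then show ?thesis
    unfolding lines_def using line_product[OF \<omega> \<Omega>D[OF assms]] by (simp add: prod.reindex)
qed

text \<open>Naming the surviving orbits by k \<omega> and k \<omega>^2 makes their parameters \<mu>
  \<omega> and \<mu> \<omega>^2, whatever k is.\<close>

lemma cube_roots_minus:
  assumes "k \<in> \<Omega>"
  shows "\<Omega> - {k} = {k * \<omega>, k * \<omega>\<^sup>2}" "k * \<omega> \<noteq> k * \<omega>\<^sup>2"
proof -
  note d = omega_distinct[OF \<omega>]
  have w: "\<omega> * \<omega> = \<omega>\<^sup>2" "\<omega> * \<omega>\<^sup>2 = 1" "\<omega>\<^sup>2 * \<omega> = 1" "\<omega>\<^sup>2 * \<omega>\<^sup>2 = \<omega>"
    using cube_reduce[OF omega_cube[OF \<omega>]] by (simp_all add: power2_eq_square mult_ac)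
  from assms consider "k = 1" | "k = \<omega>" | "k = \<omega>\<^sup>2" by (auto simp: cube_roots_def[OF \<omega>])
  then show "\<Omega> - {k} = {k * \<omega>, k * \<omega>\<^sup>2}"
    by cases (use d w in \<open>auto simp: cube_roots_def[OF \<omega>]\<close>)
  have "k \<noteq> 0" using \<Omega>D[OF assms] by auto
  with d show "k * \<omega> \<noteq> k * \<omega>\<^sup>2" by simp
qed

section \<open>The six nonzero special values of the parameter\<close>

context
  fixes k \<mu> l :: complex
  assumes k: "k \<in> \<Omega>" and \<mu>: "\<mu> = 1 \<or> \<mu> = - 2" and l: "l = \<mu> * k\<^sup>2"
begin

lemma k_cube: "k ^ 3 = 1"
  by (rule \<Omega>D[OF k])

text \<open>Since k^3 = 1, the orbit \<kappa> = k has parameter 1 or -2: it is the one that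
  degenerates.\<close>

lemma k_l: "k * l = \<mu>"
  using cube_reduce[OF k_cube] by (simp add: l power2_eq_square mult_ac)

lemma l_nonzero: "l \<noteq> 0"
  using k_l \<mu> by auto

abbreviation "smooth_part \<equiv> conics (\<Omega> - {k}) l \<union> coordinate_conics l"

text \<open>The remaining parameters are \<mu> times a primitive cube root of unity. Cubes (1
  against -8) separate them from the other exceptional value, and \<omega>, \<omega>^2 differ from
  1.\<close>

lemma nondegenerate: "\<kappa> \<in> \<Omega> - {k} \<Longrightarrow> \<kappa> * l \<noteq> 1 \<and> \<kappa> * l \<noteq> - 2"
proof -
  assume "\<kappa> \<in> \<Omega> - {k}"
  then have "\<kappa> * l = \<mu> * \<omega> \<or> \<kappa> * l = \<mu> * \<omega>\<^sup>2"
    unfolding cube_roots_minus(1)[OF k] using k_l by auto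
  moreover have "(-2) * \<omega> \<noteq> 1" "(-2) * \<omega>\<^sup>2 \<noteq> 1" "\<omega> \<noteq> - 2" "\<omega>\<^sup>2 \<noteq> - 2"
  proof -
    have "x ^ 3 = 1 \<Longrightarrow> (-2) * x \<noteq> 1 \<and> x \<noteq> - 2" for x :: complex
    proof -
      assume x: "x ^ 3 = 1"
      have "((-2) * x) ^ 3 \<noteq> 1 ^ 3" unfolding power_mult_distrib x by simp
      moreover have "x ^ 3 \<noteq> (-2) ^ 3" unfolding x by simp
      ultimately show ?thesis by metis
    qed
    moreover have "\<omega> \<in> \<Omega>" "\<omega>\<^sup>2 \<in> \<Omega>" by (simp_all add: cube_roots_def[OF \<omega>])
    ultimately show "(-2) * \<omega> \<noteq> 1" "(-2) * \<omega>\<^sup>2 \<noteq> 1" "\<omega> \<noteq> - 2" "\<omega>\<^sup>2 \<noteq> - 2"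
      using \<Omega>D by blast+
  qed
  ultimately show ?thesis
    using \<mu> omega_distinct[OF \<omega>] by auto
qed

lemma smooth_part_prime_smooth:
  assumes "q \<in> smooth_part"
  shows "prime q" "is_smooth_conic q"
  using assms conics_prime_smooth[of "\<Omega> - {k}" l q, OF _ nondegenerate]
    coordinate_conics_prime_smooth[OF l_nonzero, of q] by auto

lemma finite_smooth_part: "finite smooth_part"
  using finite_conics[of "\<Omega> - {k}" l] by (auto simp: coordinate_conics_def)

lemma lines_prime_line: "q \<in> lines k \<Longrightarrow> prime q" "q \<in> lines k \<Longrightarrow> is_line q"
  using prime_line line_is_line by (auto simp: lines_def)

lemma finite_lines: "finite (lines k)"
  unfolding lines_def using finite_cube_roots[OF \<omega>] by simp

lemma smooth_part_lines_disjoint: "smooth_part \<inter> lines k = {}"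
  using smooth_part_prime_smooth(2) lines_prime_line(2) line_not_smooth_conic by blast

lemma hesse_poly_factors: "hesse_poly \<omega> l = cnst l * \<Prod>smooth_part * (\<Prod>(lines k))\<^sup>2"
proof -
  have "(\<Prod>\<kappa>\<in>\<Omega>. \<Prod>s\<in>\<Omega>. hesse_conic \<kappa> s l) = (\<Prod>\<kappa>\<in>\<Omega>. sextic (cnst (\<kappa> * l)) (cnst \<kappa> * symB))"
    by (intro prod.cong refl triple_product[OF \<omega>] \<Omega>D)
  also have "\<dots> = sextic (cnst \<mu>) (cnst k * symB) * (\<Prod>\<kappa>\<in>\<Omega> - {k}. sextic (cnst (\<kappa> * l)) (cnst \<kappa> * symB))"
    unfolding k_l[symmetric] by (rule prod.remove[OF finite_cube_roots[OF \<omega>] k])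
  also have "sextic (cnst \<mu>) (cnst k * symB) = (\<Prod>(lines k))\<^sup>2"
    unfolding prod_lines[OF k] using \<mu>
    by (auto simp: sextic_def power2_eq_square power3_eq_cube algebra_simps)
  also have "(\<Prod>\<kappa>\<in>\<Omega> - {k}. sextic (cnst (\<kappa> * l)) (cnst \<kappa> * symB)) = \<Prod>(conics (\<Omega> - {k}) l)"
    unfolding conics_def by (rule prod_hesse_conics[OF \<omega>, symmetric]) auto
  finally have "hesse_poly \<omega> l = (\<Prod>(lines k))\<^sup>2 * \<Prod>(conics (\<Omega> - {k}) l) * (cnst l * \<Prod>(coordinate_conics l))"
    unfolding hesse_poly_eq[OF \<omega>] prod_coordinate_conics[OF l_nonzero] by simp
  moreover have "\<Prod>smooth_part = \<Prod>(conics (\<Omega> - {k}) l) * \<Prod>(coordinate_conics l)"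
    using conics_disjoint_coordinate_conics[of "\<Omega> - {k}" l] l_nonzero finite_conics[of "\<Omega> - {k}" l]
    by (intro prod.union_disjoint) (auto simp: coordinate_conics_def)
  ultimately show ?thesis by (simp add: mult_ac)
qed

lemma prod_arrangement: "\<Prod>(smooth_part \<union> lines k) = \<Prod>smooth_part * \<Prod>(lines k)"
  by (rule prod.union_disjoint[OF finite_smooth_part finite_lines smooth_part_lines_disjoint])

lemma arrangement_A_eq: "arrangement_A \<omega> l = smooth_part \<union> lines k"
  unfolding arrangement_A_def arrangement_C_def
proof (rule set_prime_factorization_eqI)
  show "finite (smooth_part \<union> lines k)" using finite_smooth_part finite_lines by blast
  show "prime p" if "p \<in> smooth_part \<union> lines k" for p
    using that smooth_part_prime_smooth(1) lines_prime_line(1) by blast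
  show "\<Prod>(smooth_part \<union> lines k) dvd hesse_poly \<omega> l"
    unfolding prod_arrangement hesse_poly_factors
    by (rule dvdI[of _ _ "cnst l * \<Prod>(lines k)"]) (simp add: power2_eq_square mult_ac)
  \<comment> \<open>The lines already occur squared in the Hesse polynomial, so only a second copy
    of the smooth part is missing.\<close>
  have "(\<Prod>(smooth_part \<union> lines k))\<^sup>2 = hesse_poly \<omega> l * (cnst (1 / l) * \<Prod>smooth_part)"
    unfolding prod_arrangement hesse_poly_factors
    by (simp add: power2_eq_square mult_ac cnst_inverse_mult[OF l_nonzero])
  then show "hesse_poly \<omega> l dvd (\<Prod>(smooth_part \<union> lines k))\<^sup>2" by (rule dvdI)
qed

lemma arrangement_B_eq: "arrangement_B \<omega> l = smooth_part"
  unfolding arrangement_B_def arrangement_A_eq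
  using smooth_part_prime_smooth(2) lines_prime_line(2) line_not_smooth_conic by blast

lemma conic_line_arrangement_A: "conic_line_arrangement (arrangement_A \<omega> l)"
  unfolding arrangement_A_eq conic_line_arrangement_def
  using finite_smooth_part finite_lines smooth_part_prime_smooth(2) lines_prime_line(2) by blast

lemma conic_arrangement_B: "conic_arrangement (arrangement_B \<omega> l)"
  unfolding arrangement_B_eq conic_arrangement_def
  using finite_smooth_part smooth_part_prime_smooth(2) by blast

lemma squarefree_arrangements:
  "squarefree (\<Prod>smooth_part)" "squarefree (\<Prod>(smooth_part \<union> lines k))"
  using finite_smooth_part finite_lines smooth_part_prime_smooth(1) lines_prime_line(1)
  by (intro squarefree_prod_primes; blast)+

lemma prod_smooth_part:
  "\<Prod>smooth_part =
     sextic (cnst \<mu> * cnst \<omega>) (cnst \<omega> * (cnst k * symB)) *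
     sextic (cnst \<mu> * (cnst \<omega>)\<^sup>2) ((cnst \<omega>)\<^sup>2 * (cnst k * symB)) *
     (cnst (1 / l) * (cnst l * symA * symB - (cnst l)\<^sup>2 * symC + ((cnst l) ^ 3 - 1) * symB\<^sup>2))"
proof -
  have kl: "k * \<omega> * l = \<mu> * \<omega>" "k * \<omega>\<^sup>2 * l = \<mu> * \<omega>\<^sup>2"
    using k_l by (simp_all flip: k_l add: mult_ac)
  have "\<Prod>smooth_part = \<Prod>(conics (\<Omega> - {k}) l) * \<Prod>(coordinate_conics l)"
    using conics_disjoint_coordinate_conics[of "\<Omega> - {k}" l] l_nonzero finite_conics[of "\<Omega> - {k}" l]
    by (intro prod.union_disjoint) (auto simp: coordinate_conics_def)
  moreover have "\<Prod>(conics (\<Omega> - {k}) l) = (\<Prod>\<kappa>\<in>\<Omega> - {k}. sextic (cnst (\<kappa> * l)) (cnst \<kappa> * symB))"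
    unfolding conics_def by (rule prod_hesse_conics[OF \<omega>]) auto
  moreover have "\<dots> = sextic (cnst (k * \<omega> * l)) (cnst (k * \<omega>) * symB) *
      sextic (cnst (k * \<omega>\<^sup>2 * l)) (cnst (k * \<omega>\<^sup>2) * symB)"
    unfolding cube_roots_minus(1)[OF k] using cube_roots_minus(2)[OF k] by simp
  moreover have "\<Prod>(coordinate_conics l) = cnst (1 / l) * (cnst l * \<Prod>(coordinate_conics l))"
    using cnst_inverse_mult(2)[OF l_nonzero] by simp
  ultimately show ?thesis
    unfolding kl prod_coordinate_conics[OF l_nonzero] coordinate_conics_expansion
    by (simp add: symA_def symB_def symC_def mult_ac)
qed


lemma prod_smooth_part_1:
  fixes B :: poly3
  defines "B \<equiv> cnst k * symB"
  assumes "\<mu> = 1"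
  shows "\<Prod>smooth_part = cnst (- k / (27 * l)) *
    ((symA - 3 * B) ^ 6 - (symA\<^sup>2 + 3 * symA * B + 9 * B\<^sup>2 - 9 * symC) ^ 3)"
proof -
  have K: "cnst k ^ 3 = 1" using k_cube by (metis cnst_power cnst_simps(2))
  have L: "cnst l = (cnst k)\<^sup>2" using l assms(2) by simp
  have Q: "cnst l * symA * symB - (cnst l)\<^sup>2 * symC + ((cnst l) ^ 3 - 1) * symB\<^sup>2
      = - (cnst k * (symC - symA * B))"
    unfolding L B_def
    by (simp add: power2_eq_square power3_eq_cube right_diff_distrib mult_ac cube_reduce[OF K])
  \<comment> \<open>The constant combines 1/l from normalizing the third coordinate conic, -k from
    \<open>Q\<close>, and 1/27 from the pencil identity.\<close>
  have "- k / (27 * l) * 27 = - (1 / l * k)" by simp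
  then have c: "cnst (- k / (27 * l)) * 27 = - (cnst (1 / l) * cnst k)"
    by (metis cnst_numeral cnst_simps(4,6))
  show ?thesis
    unfolding prod_smooth_part Q pencil_product_1[OF cnst_omega[OF \<omega>], symmetric] assms(2) B_def[symmetric]
      mult.assoc[symmetric, of "cnst (- k / (27 * l))"] c
    by (simp add: sextic_def mult_ac)
qed

lemma prod_smooth_part_2:
  fixes B :: poly3
  defines "B \<equiv> cnst k * symB"
  assumes "\<mu> = - 2"
  shows "\<Prod>smooth_part = cnst (- k / (27 * l)) *
    ((symA - 3 * B) ^ 6 - (symA\<^sup>2 - 24 * symA * B - 72 * B\<^sup>2 - 36 * symC) ^ 3)"
proof -
  have K: "cnst k ^ 3 = 1" using k_cube by (metis cnst_power cnst_simps(2))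
  have L: "cnst l = - 2 * (cnst k)\<^sup>2" using l assms(2) by simp
  have Q: "cnst l * symA * symB - (cnst l)\<^sup>2 * symC + ((cnst l) ^ 3 - 1) * symB\<^sup>2
      = - (cnst k * (4 * symC + 2 * symA * B + 9 * B\<^sup>2))"
    unfolding L B_def
    by (simp add: power2_eq_square power3_eq_cube algebra_simps cube_reduce[OF K])
  have "- k / (27 * l) * 27 = - (1 / l * k)" by simp
  then have c: "cnst (- k / (27 * l)) * 27 = - (cnst (1 / l) * cnst k)"
    by (metis cnst_numeral cnst_simps(4,6))
  show ?thesis
    unfolding prod_smooth_part Q pencil_product_2[OF cnst_omega[OF \<omega>], symmetric] assms(2) B_def[symmetric]
      mult.assoc[symmetric, of "cnst (- k / (27 * l))"] c
    by (simp add: sextic_def mult_ac)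
qed

lemma coefficient_nonzero: "- k / (27 * l) \<noteq> 0"
  using k_cube l_nonzero by auto

lemma free_B: "\<mu> = 1 \<Longrightarrow> free_with_exponents (\<Prod>(arrangement_B \<omega> l)) 7 10"
  using free_sextics_1(1)[OF k_cube coefficient_nonzero] squarefree_arrangements(1)
  by (simp only: arrangement_B_eq prod_smooth_part_1)

lemma free_A: "free_with_exponents (\<Prod>(arrangement_A \<omega> l)) 7 13"
  using \<mu>
proof
  assume "\<mu> = 1"
  have "\<Prod>(smooth_part \<union> lines k) = cnst (- k / (27 * l)) * ((symA - 3 * (cnst k * symB)) * ((symA - 3 * (cnst k * symB)) ^ 6
      - (symA\<^sup>2 + 3 * symA * (cnst k * symB) + 9 * (cnst k * symB)\<^sup>2 - 9 * symC) ^ 3))"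
    unfolding prod_arrangement prod_lines[OF k] prod_smooth_part_1[OF \<open>\<mu> = 1\<close>] by (simp only: mult_ac)
  then show ?thesis
    using free_sextics_1(2)[OF k_cube coefficient_nonzero] squarefree_arrangements(2)
    unfolding arrangement_A_eq by simp
next
  assume "\<mu> = - 2"
  have "\<Prod>(smooth_part \<union> lines k) = cnst (- k / (27 * l)) * ((symA - 3 * (cnst k * symB)) * ((symA - 3 * (cnst k * symB)) ^ 6
      - (symA\<^sup>2 - 24 * symA * (cnst k * symB) - 72 * (cnst k * symB)\<^sup>2 - 36 * symC) ^ 3))"
    unfolding prod_arrangement prod_lines[OF k] prod_smooth_part_2[OF \<open>\<mu> = - 2\<close>] by (simp only: mult_ac)
  then show ?thesis
    using free_sextics_2[OF k_cube coefficient_nonzero] squarefree_arrangements(2)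
    unfolding arrangement_A_eq by simp
qed

end

section \<open>The parameter 0, where the coordinate conics degenerate to xy, xz and yz\<close>

abbreviation "arrangement_0 \<equiv> conics \<Omega> 0 \<union> {varX, varY, varZ}"

lemma conics_0_prime_smooth:
  assumes "q \<in> conics \<Omega> 0" shows "prime q" "is_smooth_conic q"
  using conics_prime_smooth[of \<Omega> 0 q] assms by auto

lemma variable_is_line: "q \<in> {varX, varY, varZ} \<Longrightarrow> prime q \<and> is_line q"
  using prime_varX prime_varY prime_varZ by (auto simp: is_line_def)

text \<open>Every orbit has N = 0 here, and its sextic is 3 (\<kappa> B)^2 - H with H = 4 C - A^2;
  multiplying over the three \<kappa> leaves only the pure powers.\<close>

lemma prod_conics_0: "\<Prod>(conics \<Omega> 0) = 27 * symB ^ 6 - (4 * symC - symA\<^sup>2) ^ 3"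
proof -
  have s: "sextic 0 B = 3 * B\<^sup>2 - (4 * symC - symA\<^sup>2)" for B
    by (simp add: sextic_def)
  have "\<Prod>(conics \<Omega> 0) = (\<Prod>\<kappa>\<in>\<Omega>. sextic (cnst (\<kappa> * 0)) (cnst \<kappa> * symB))"
    unfolding conics_def by (rule prod_hesse_conics[OF \<omega>]) simp
  also have "\<dots> = 27 * symB ^ 6 - (4 * symC - symA\<^sup>2) ^ 3"
    unfolding prod_cube_roots[OF \<omega>] sextic_product_0[OF cnst_omega[OF \<omega>], symmetric] by (simp add: s)
  finally show ?thesis .
qed

lemma prod_arrangement_0: "\<Prod>arrangement_0 = \<Prod>(conics \<Omega> 0) * symB"
proof -
  have "conics \<Omega> 0 \<inter> {varX, varY, varZ} = {}"
    using conics_0_prime_smooth(2) variable_is_line line_not_smooth_conic by blast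
  then have "\<Prod>arrangement_0 = \<Prod>(conics \<Omega> 0) * \<Prod>{varX, varY, varZ}"
    using finite_conics[of \<Omega> 0] by (intro prod.union_disjoint) auto
  moreover have "varX \<noteq> varY" "varX \<noteq> varZ" "varY \<noteq> varZ"
    by (simp_all add: varX_def varY_def varZ_def one_pCons)
  ultimately show ?thesis by (simp add: symB_def mult_ac)
qed

lemma squarefree_arrangement_0: "squarefree (\<Prod>arrangement_0)"
  using finite_conics[of \<Omega> 0] conics_0_prime_smooth(1) variable_is_line
  by (intro squarefree_prod_primes; blast)

lemma arrangement_A_0: "arrangement_A \<omega> 0 = arrangement_0"
  unfolding arrangement_A_def arrangement_C_def
proof (rule set_prime_factorization_eqI)
  have "(\<Prod>\<kappa>\<in>\<Omega>. \<Prod>s\<in>\<Omega>. hesse_conic \<kappa> s 0) = (\<Prod>\<kappa>\<in>\<Omega>. sextic (cnst (\<kappa> * 0)) (cnst \<kappa> * symB))"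
    by (intro prod.cong refl triple_product[OF \<omega>] \<Omega>D)
  also have "\<dots> = \<Prod>(conics \<Omega> 0)"
    unfolding conics_def by (rule prod_hesse_conics[OF \<omega>, symmetric]) simp
  finally have h: "hesse_poly \<omega> 0 = - (\<Prod>(conics \<Omega> 0) * symB\<^sup>2)"
    unfolding hesse_poly_eq[OF \<omega>] by (simp add: symB_def power2_eq_square mult_ac)
  show "finite arrangement_0" using finite_conics[of \<Omega> 0] by simp
  show "prime p" if "p \<in> arrangement_0" for p
    using that conics_0_prime_smooth(1) variable_is_line by blast
  show "\<Prod>arrangement_0 dvd hesse_poly \<omega> 0"
    unfolding prod_arrangement_0 h by (rule dvdI[of _ _ "- symB"]) (simp add: power2_eq_square mult_ac)
  show "hesse_poly \<omega> 0 dvd (\<Prod>arrangement_0)\<^sup>2"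
    unfolding prod_arrangement_0 h
    by (rule dvdI[of _ _ "- \<Prod>(conics \<Omega> 0)"]) (simp add: power2_eq_square mult_ac)
qed

lemma conic_line_arrangement_A_0: "conic_line_arrangement (arrangement_A \<omega> 0)"
  unfolding arrangement_A_0 conic_line_arrangement_def
  using finite_conics[of \<Omega> 0] conics_0_prime_smooth(2) variable_is_line by auto

lemma free_A_0: "free_with_exponents (\<Prod>(arrangement_A \<omega> 0)) 7 13"
proof (rule free_sextics_0[of _ 1])
  show "squarefree (\<Prod>(arrangement_A \<omega> 0))"
    unfolding arrangement_A_0 by (rule squarefree_arrangement_0)
  show "\<Prod>(arrangement_A \<omega> 0) = cnst 1 * (symB * (27 * symB ^ 6 - (4 * symC - symA\<^sup>2) ^ 3))"
    unfolding arrangement_A_0 prod_arrangement_0 prod_conics_0 by (simp add: mult.commute)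
qed simp

end

theorem theorem6p1:
  fixes \<omega> :: complex
  assumes "\<omega>^2 + \<omega> + 1 = 0"
  shows "(\<forall>l \<in> {-2, -2 * \<omega>, -2 * \<omega>^2, 0, 1, \<omega>, \<omega>^2}.
            conic_line_arrangement (arrangement_A \<omega> l) \<and>
            free_with_exponents (\<Prod>q\<in>arrangement_A \<omega> l. q) 7 13) \<and>
         (\<forall>l \<in> {1, \<omega>, \<omega>^2}.
            conic_arrangement (arrangement_B \<omega> l) \<and>
            free_with_exponents (\<Prod>q\<in>arrangement_B \<omega> l. q) 7 10)"
proof -
  note w = assms
  have w4: "(\<omega>\<^sup>2)\<^sup>2 = \<omega>"
    using cube_reduce[OF omega_cube[OF w]] by (simp add: power2_eq_square mult_ac)
  have roots: "1 \<in> cube_roots \<omega>" "\<omega> \<in> cube_roots \<omega>" "\<omega>\<^sup>2 \<in> cube_roots \<omega>"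
    by (simp_all add: cube_roots_def[OF w])
  \<comment> \<open>Squaring permutes the cube roots of unity, so each s has the form k^2 required
    by the parametrization.\<close>
  have square: "\<exists>k\<in>cube_roots \<omega>. s = k\<^sup>2" if "s \<in> {1, \<omega>, \<omega>\<^sup>2}" for s
    using that roots w4 by (metis empty_iff insert_iff one_power2)
  have A: "conic_line_arrangement (arrangement_A \<omega> l) \<and> free_with_exponents (\<Prod>(arrangement_A \<omega> l)) 7 13"
    if "l = \<mu> * s" "\<mu> = 1 \<or> \<mu> = - 2" "s \<in> {1, \<omega>, \<omega>\<^sup>2}" for l \<mu> s
    using square[OF that(3)] conic_line_arrangement_A[OF w _ that(2)] free_A[OF w _ that(2)] that(1) by blast
  have B: "conic_arrangement (arrangement_B \<omega> l) \<and> free_with_exponents (\<Prod>(arrangement_B \<omega> l)) 7 10"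
    if "l \<in> {1, \<omega>, \<omega>\<^sup>2}" for l
    using square[OF that] conic_arrangement_B[OF w, of _ 1 l] free_B[OF w, of _ 1 l] by auto
  show ?thesis
    \<comment> \<open>The instance with s = 1 supplies the value -2, which is not written as a
      product in the goal.\<close>
    using A[of _ 1] A[of _ "- 2"] A[of "- 2" "- 2" 1] B conic_line_arrangement_A_0[OF w] free_A_0[OF w] by auto
qed

end
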